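(* Let $P$ be a finite poset with $|P|\ge 2$, and let $C_P$ be a constant and $n_0$ a positive integer such that $\mathrm{La}^*(n,P)\leq C_P\binom{n}{\lfloor n/2\rfloor}$ for all $n\geq n_0$. Let $t$ be a positive integer. Then there exists $n_1$ such that for all $n\geq n_1$ the following holds for all $k$ satisfying $8\leq k\leq \sqrt{4n/n_0}$. Let $\mathcal F\subseteq 2^{[n]}$ satisfy $|\mathcal F|=k\,t\,C_P\binom{n}{\lfloor n/2\rfloor}$. Then there exists a collection $\mathcal H$ of induced copies of $P$ in $\mathcal F$ such that: 1. $|\mathcal H|\geq \frac{1}{2t}\,(k/8)^{2t\mu(P)(|P|-1)}\,|\mathcal F|$; 2. for every nonempty $S\subseteq 2^{[n]}$, $\deg_{\mathcal H}(S)\leq 2K_P\cdot (k/8)^{2t\mu(P)(|P|-|S|)}$, where $K_P=2^{|P|+\log_2|P|+2}$.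
   Context: $[n]=\{1,\dots,n\}$, and $2^{[n]}$ is the power set of $[n]$ partially ordered by inclusion. An induced copy of a finite poset $P$ in a family $\mathcal F\subseteq 2^{[n]}$ is a subfamily of $\mathcal F$ that is the image of an injective map $f:P\to\mathcal F$ such that $f(x)\subsetneq f(y)$ if and only if $x<_P y$ (such a map is called an induced embedding). $\mathrm{La}^*(n,P)$ is the largest size of a family in $2^{[n]}$ containing no induced copy of $P$. For a collection $\mathcal H$ of induced copies of $P$ (each viewed as a $|P|$-element subset of $2^{[n]}$) and $S\subseteq 2^{[n]}$, $\deg_{\mathcal H}(S)$ is the number of members of $\mathcal H$ that contain $S$ as a subset. For a nonempty $S\subseteq 2^{[n]}$, let $d(S)=|\bigcup S\setminus\bigcap S|$, where $\bigcup S$ and $\bigcap S$ are the union and intersection of all members of $S$. For a finite poset $D$, let $d^*(D)=\min\{d(\varphi(D)):\varphi \text{ is an induced embedding of } D \text{ into } 2^{[n]}\text{ for some } n\}$. Let $\mu(P)=\min_{D\subseteq P,\ |D|\geq 2}\frac{d^*(D)}{|D|-1}$, where subsets $D$ of $P$ carry the induced order. *)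

theory Defs
  imports Complex_Main
begin

text \<open>
  A poset is a carrier set \<open>P\<close> with a reflexive order \<open>r\<close> such that \<open>partial_order_on P r\<close>;
  its strict order is \<open>(x, y) \<in> r \<and> x \<noteq> y\<close>. Every notion below looks at \<open>r\<close> only on the given
  carrier, so for \<open>D \<subseteq> P\<close> the pair \<open>D\<close>, \<open>r\<close> stands for \<open>D\<close> with the induced order.
  The Boolean lattice on \<open>n\<close> points is \<open>Pow {1..n}\<close>.
\<close>

definition induced_embedding :: "'a set \<Rightarrow> 'a rel \<Rightarrow> nat set set \<Rightarrow> ('a \<Rightarrow> nat set) \<Rightarrow> bool" where
  "induced_embedding P r F f \<longleftrightarrow>
     f ` P \<subseteq> F \<and> inj_on f P \<and>
     (\<forall>x\<in>P. \<forall>y\<in>P. f x \<subset> f y \<longleftrightarrow> (x, y) \<in> r \<and> x \<noteq> y)"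

definition induced_copies :: "'a set \<Rightarrow> 'a rel \<Rightarrow> nat set set \<Rightarrow> nat set set set" where
  "induced_copies P r F = {f ` P | f. induced_embedding P r F f}"

definition La_star :: "nat \<Rightarrow> 'a set \<Rightarrow> 'a rel \<Rightarrow> nat" where
  "La_star n P r = Max {card F | F. F \<subseteq> Pow {1..n} \<and> induced_copies P r F = {}}"

definition family_degree :: "nat set set set \<Rightarrow> nat set set \<Rightarrow> nat" where
  "family_degree H S = card {A \<in> H. S \<subseteq> A}"

definition diam :: "nat set set \<Rightarrow> nat" where
  "diam S = card (\<Union>S - \<Inter>S)"

text \<open>The infimum is over a set of natural numbers, hence a minimum; \<open>n\<close> ranges over all dimensions.\<close>

definition d_star :: "'a set \<Rightarrow> 'a rel \<Rightarrow> nat" where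
  "d_star D r = Inf {diam (\<phi> ` D) | \<phi> n. induced_embedding D r (Pow {1..n}) \<phi>}"

definition mu :: "'a set \<Rightarrow> 'a rel \<Rightarrow> real" where
  "mu P r = Min {real (d_star D r) / (real (card D) - 1) | D. D \<subseteq> P \<and> 2 \<le> card D}"

definition K_const :: "'a set \<Rightarrow> real" where
  "K_const P = 2 powr (real (card P) + log 2 (real (card P)) + 2)"

end

theory Submission
  imports Defs
begin

text \<open>
  Let \<open>k\<close> be given, put \<open>m = \<lceil>4n / k\<^sup>2\<rceil>\<close>, and look at copies \<open>Q\<close> of the Boolean lattice on \<open>m\<close> points
  inside that on \<open>n\<close> points. Choose \<open>m\<close> disjoint blocks of \<open>s\<close> points each and a base set \<open>A\<close> outside
  them; \<open>Q\<close> consists of the unions of \<open>A\<close> with some of the blocks. The middle binomial coefficients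
  satisfy \<open>(n choose n/2) / 2^n \<approx> sqrt (m/n) (m choose m/2) / 2^m\<close> up to constants close to \<open>1\<close>, and
  \<open>sqrt (m/n) \<ge> 2/k\<close> (\<open>middle_binomial_ratio\<close>). So a family \<open>F\<close> of \<open>k t C (n choose n/2)\<close> sets meets an
  average \<open>Q\<close> in more than \<open>C (m choose m/2)\<close> sets, with a margin that covers the losses below. The
  bound on \<open>La_star m P r\<close>, which is available because \<open>k \<le> sqrt (4n/n0)\<close> gives \<open>m \<ge> n0\<close>, yields a copy of \<open>P\<close> in \<open>F\<close> inside \<open>Q\<close>.

  Many well-spread copies come from a maximality argument (\<open>balanced_collection\<close>). Write
  \<open>D = (k/8) powr (2 t mu P)\<close> and let \<open>H\<close> be a largest collection of copies that obeys the degree bounds.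
  Suppose that \<open>H\<close> is smaller than claimed. By counting incidences only few members of \<open>F\<close> have a
  degree near the bound for singletons; drop them. Call a set \<open>S\<close> of at least two remaining members
  saturated if its degree is at least \<open>D ^ (|P| - |S|)\<close>; the members of \<open>H\<close> themselves are saturated.
  If \<open>Q\<close> contains fewer saturated sets than the excess of \<open>F \<inter> Q\<close> over \<open>La_star m P r\<close>, deleting one
  member of each of them leaves a copy of \<open>P\<close> that can be added to \<open>H\<close>: a contradiction.

  Saturated sets are rare in \<open>Q\<close> for the following reason. A set \<open>S \<subseteq> Q\<close> which is the image of a
  subset \<open>E\<close> of \<open>P\<close> corresponds to an embedding of \<open>E\<close> into the lattice on the \<open>m\<close> blocks, hence the
  members of \<open>S\<close> differ in \<open>d \<ge> d_star E \<ge> mu P (|S| - 1)\<close> blocks (\<open>d_star_le_blocks\<close>). All these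
  blocks have to be found inside the set \<open>\<Union>S - \<Inter>S\<close> of size \<open>d s\<close>, so among the cubes through a fixed
  \<open>B \<in> S\<close> a fraction of at most \<open>(a m (d s)^(s-1) / n^s)^d\<close>, with \<open>a\<close> depending on \<open>s\<close>, contains \<open>S\<close>
  (\<open>cubes_containing_upper\<close>). This has to beat \<open>D ^ (|S| - 1) \<le> (k/8)^(2 t d)\<close>. Single points as
  blocks would give roughly \<open>(4/k\<^sup>2)^d\<close>, and larger blocks gain further factors as long as they
  cover only a small part of the \<open>n\<close> points. For large \<open>k\<close> blocks of size \<open>t + 1\<close> work; for
  bounded \<open>k\<close> the number \<open>D\<close> is bounded and blocks of size \<open>2\<close> gain a factor of order \<open>1/n\<close>.

  Blocks of more than one point do not hit all sets equally often: a set far from the middle layer lies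
  in many more cubes. Two observations make this harmless. The number of cubes through \<open>B\<close>
  is bounded below by essentially its average for every \<open>B\<close>, by a convexity property of binomial
  coefficients (\<open>binomial_split_lower\<close>), and the fraction above is relative to the cubes through \<open>B\<close>.
\<close>

section \<open>Middle binomial coefficients\<close>

lemma central_binomial_Suc:
  "real (2 * Suc j choose Suc j) * real (Suc j) = 2 * (2 * real j + 1) * real (2 * j choose j)"
proof -
  have a: "Suc j * (Suc (2*j+1) choose Suc j) = Suc (2*j+1) * (2*j+1 choose j)"
    by (rule Suc_times_binomial)
  have b: "Suc j * (2*j+1 choose j) = (2*j+1) * (2*j choose j)"
    using binomial_absorb_comp[of "2*j+1" j] by simp
  have e: "2 * Suc j = Suc (2*j+1)" by simp
  have "Suc j * (Suc j * (2 * Suc j choose Suc j)) = Suc j * (Suc (2*j+1) * (2*j+1 choose j))"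
    by (simp only: e a)
  also have "\<dots> = Suc (2*j+1) * (Suc j * (2*j+1 choose j))" by (rule mult.left_commute)
  also have "\<dots> = Suc j * (2 * ((2*j+1) * (2*j choose j)))" unfolding b by simp
  finally have "Suc j * (2 * Suc j choose Suc j) = 2 * ((2*j+1) * (2*j choose j))" 
    using mult_cancel1[of "Suc j"] by (metis Suc_not_Zero)
  hence "real (Suc j * (2 * Suc j choose Suc j)) = real (2 * ((2*j+1) * (2*j choose j)))" by (rule arg_cong)
  thus ?thesis by (simp only: of_nat_mult of_nat_add of_nat_1 of_nat_numeral mult_ac)
qed

text \<open>
  Passing from \<open>j\<close> to \<open>j + 1\<close> multiplies \<open>(2j choose j) / 4^j\<close> by \<open>(2j+1) / (2j+2)\<close>. Hence its square
  times \<open>2j + 1\<close> decreases, and its square times \<open>j\<close> increases.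
\<close>
lemma central_binomial_even_upper: "(real (2*j choose j))\<^sup>2 * (2 * real j + 1) \<le> 16 ^ j"
proof (induction j)
  case (Suc j)
  define x b b' where "x = real j" and "b = real (2*j choose j)" and "b' = real (2 * Suc j choose Suc j)"
  have x: "x \<ge> 0" by (simp add: x_def)
  have e: "b' * (x + 1) = 2 * (2*x+1) * b"
    using central_binomial_Suc[of j] unfolding x_def b_def b'_def by (simp only: of_nat_Suc add.commute)
  have IH: "b\<^sup>2 * (2*x+1) \<le> 16^j" using Suc.IH by (simp only: x_def b_def)
  have "(x+1)\<^sup>2 * (b'\<^sup>2 * (2*x+3)) = (b' * (x+1))\<^sup>2 * (2*x+3)" by (simp add: power_mult_distrib)
  also have "\<dots> = (b\<^sup>2 * (2*x+1)) * (4*(2*x+1)*(2*x+3))" unfolding e by (simp add: power2_eq_square algebra_simps)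
  also have "\<dots> \<le> 16^j * (4*(2*x+1)*(2*x+3))"
    using x by (intro mult_right_mono[OF IH]) auto
  also have "\<dots> \<le> 16^j * (16 * (x+1)\<^sup>2)"
    by (intro mult_left_mono) (auto simp: power2_eq_square algebra_simps)
  also have "\<dots> = (x+1)\<^sup>2 * 16^(Suc j)" by simp
  finally have "b'\<^sup>2 * (2*x+3) \<le> 16^(Suc j)" 
    by (rule mult_left_le_imp_le) (use x in auto)
  thus ?case unfolding x_def b'_def[symmetric] by (simp add: algebra_simps)
qed simp

lemma central_binomial_even_lower: "16 ^ Suc j \<le> 4 * (real j + 1) * (real (2*Suc j choose Suc j))\<^sup>2"
proof (induction j)
  case (Suc j)
  define x b b' where "x = real j + 1" and "b = real (2*Suc j choose Suc j)" 
    and "b' = real (2 * Suc (Suc j) choose Suc (Suc j))"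
  have x: "x > 0" by (simp add: x_def)
  have e: "b' * (x + 1) = 2 * (2*x+1) * b"
    using central_binomial_Suc[of "Suc j"] unfolding x_def b_def b'_def by (simp only: of_nat_Suc add.commute)
  have IH: "16 ^ Suc j \<le> 4 * x * b\<^sup>2" using Suc.IH by (simp only: x_def b_def)
  have "(x+1)\<^sup>2 * 16 ^ Suc (Suc j) \<le> (x+1)\<^sup>2 * (16 * (4 * x * b\<^sup>2))"
    using IH by (intro mult_left_mono) auto
  also have "\<dots> = (4 * (x+1) * b\<^sup>2) * (16 * (x * (x+1)))" by (simp add: power2_eq_square)
  also have "\<dots> \<le> (4 * (x+1) * b\<^sup>2) * (4*(2*x+1)\<^sup>2)"
    using x by (intro mult_left_mono mult_nonneg_nonneg) (auto simp: power2_eq_square algebra_simps)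
  also have "\<dots> = 4 * (x+1) * (2*(2*x+1)*b)\<^sup>2" by (simp add: power2_eq_square algebra_simps)
  also have "\<dots> = (x+1)\<^sup>2 * (4 * (x+1) * b'\<^sup>2)" unfolding e[symmetric] by (simp add: power_mult_distrib)
  finally have "16 ^ Suc (Suc j) \<le> 4 * (x+1) * b'\<^sup>2" by (rule mult_left_le_imp_le) (use x in auto)
  thus ?case unfolding x_def b'_def[symmetric] by (simp add: algebra_simps)
qed (simp add: choose_two)

lemma central_binomial_eq_double: "2 * (2*j+1 choose j) = (2 * Suc j choose Suc j)"
proof -
  have "(2 * Suc j choose Suc j) = (2*j+1 choose j) + (2*j+1 choose Suc j)" by simp
  moreover have "(2*j+1 choose Suc j) = (2*j+1 choose j)"
    using binomial_symmetric[of j "2*j+1"] by simp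
  ultimately show ?thesis by simp
qed

lemma middle_binomial_upper: "(real (m choose (m div 2)))\<^sup>2 * (real m + 1) \<le> 4 ^ m"
proof (cases "even m")
  case True
  then obtain j where m: "m = 2*j" by blast
  show ?thesis using central_binomial_even_upper[of j] by (simp add: m power_mult)
next
  case False
  then obtain j where m: "m = 2*j+1" using oddE by blast
  have p: "(4::real) ^ m = 4 * 16 ^ j" by (simp add: m power_mult)
  have "4 * ((real (m choose (m div 2)))\<^sup>2 * (real m + 1)) \<le> (real (2*Suc j choose Suc j))\<^sup>2 * (2 * real (Suc j) + 1)"
    unfolding central_binomial_eq_double[of j, symmetric] m by (simp add: power2_eq_square mult_left_mono)
  also have "\<dots> \<le> 16 ^ Suc j" by (rule central_binomial_even_upper)
  finally show ?thesis unfolding p by (simp add: mult.commute)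
qed

lemma middle_binomial_lower: "4 ^ n \<le> 2 * (real n + 1) * (real (n choose (n div 2)))\<^sup>2"
proof (cases "even n")
  case True
  then obtain i where n: "n = 2*i" by blast
  show ?thesis
  proof (cases i)
    case (Suc j)
    have "16 ^ Suc j \<le> 4 * (real j + 1) * (real (2*Suc j choose Suc j))\<^sup>2"
      by (rule central_binomial_even_lower)
    also have "\<dots> \<le> 2 * (real n + 1) * (real (2*Suc j choose Suc j))\<^sup>2"
      by (intro mult_right_mono) (auto simp: n Suc)
    finally show ?thesis unfolding n Suc power_mult by simp
  qed (simp add: n)
next
  case False
  then obtain j where n: "n = 2*j+1" using oddE by blast
  have p: "(4::real) ^ n = 4 * 16 ^ j" by (simp add: n power_mult)
  show ?thesis using central_binomial_even_lower[of j]
    unfolding central_binomial_eq_double[of j, symmetric] p by (simp add: n power2_eq_square algebra_simps)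
qed

text \<open>
  The squares of \<open>(n choose n/2) / 2^n\<close> and \<open>(m choose m/2) / 2^m\<close> compare up to a factor \<open>2\<close> like
  \<open>1 / (n+1)\<close> and \<open>1 / (m+1)\<close>; since \<open>k\<^sup>2 m \<ge> 4 n\<close>, this leaves the factor \<open>sqrt 2 > 1.4\<close>. It is this
  surplus over \<open>1\<close> that pays for all later losses.
\<close>
lemma middle_binomial_ratio:
  fixes k :: real
  assumes "0 < n" "m \<le> n" "4 * real n \<le> k\<^sup>2 * real m" "k \<ge> 0"
  shows "1.4 * (real (m choose (m div 2)) * 2 ^ n) \<le> k * real (n choose (n div 2)) * 2 ^ m"
proof -
  let ?M = "real (m choose (m div 2))" and ?N = "real (n choose (n div 2))"
  have "4 * (real n + 1) \<le> k\<^sup>2 * (real m + 1)"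
  proof -
    have "m > 0" using assms by (cases "m = 0") auto
    have "k\<^sup>2 \<ge> 4" 
    proof -
      have "4 * real m \<le> k\<^sup>2 * real m" using assms by (smt (verit) of_nat_mono)
      thus ?thesis using \<open>m > 0\<close> by (simp add: mult_le_cancel_right)
    qed
    thus ?thesis using assms(3) by (simp add: algebra_simps)
  qed
  hence "(?M\<^sup>2 * 4^n) * (4 * (real n + 1)) \<le> (?M\<^sup>2 * 4^n) * (k\<^sup>2 * (real m + 1))"
    by (rule mult_left_mono) auto
  also have "\<dots> = (?M\<^sup>2 * (real m + 1)) * (k\<^sup>2 * 4^n)" by algebra
  also have "\<dots> \<le> 4^m * (k\<^sup>2 * 4^n)"
    by (rule mult_right_mono[OF middle_binomial_upper]) auto
  also have "\<dots> \<le> 4^m * (k\<^sup>2 * (2 * (real n + 1) * ?N\<^sup>2))"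
    using middle_binomial_lower[of n] by (intro mult_left_mono) auto
  finally have "(2 * (real n + 1)) * (2 * (?M\<^sup>2 * 4^n)) \<le> (2 * (real n + 1)) * (4^m * k\<^sup>2 * ?N\<^sup>2)"
    by (simp add: algebra_simps)
  hence "2 * (?M\<^sup>2 * 4^n) \<le> 4^m * k\<^sup>2 * ?N\<^sup>2" by (rule mult_left_le_imp_le) auto
  moreover have "(4::real)^i = (2^i)\<^sup>2" for i by (simp add: power2_eq_square flip: power_mult_distrib)
  ultimately have "2 * (?M * 2^n)\<^sup>2 \<le> (k * ?N * 2^m)\<^sup>2"
    by (simp add: power_mult_distrib mult_ac)
  moreover have "(1.4 * (?M * 2^n))\<^sup>2 \<le> 2 * (?M * 2^n)\<^sup>2"
    by (simp add: power_mult_distrib power2_eq_square mult_right_mono)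
  ultimately have "(1.4 * (?M * 2^n))\<^sup>2 \<le> (k * ?N * 2^m)\<^sup>2" by linarith
  thus ?thesis using assms(4) by (intro power2_le_imp_le[OF _ mult_nonneg_nonneg[OF mult_nonneg_nonneg]]) auto
qed

section \<open>A convexity property of binomial coefficients\<close>

lemma Suc_times_binomial_real:
  "real (Suc s) * real (b choose Suc s) = (real b - real s) * real (b choose s)"
proof (cases "s \<le> b")
  case True
  have "Suc s * (b choose Suc s) = (b - s) * (b choose s)" 
    using binomial_absorption[of s b] binomial_absorb_comp[of b s] by simp
  hence "real (Suc s * (b choose Suc s)) = real ((b - s) * (b choose s))" by simp
  thus ?thesis using True by (simp only: of_nat_mult of_nat_diff)
qed (simp add: binomial_eq_0)

text \<open>
  Split \<open>b + c\<close> points into two parts of sizes \<open>b\<close> and \<open>c\<close>. The proportion of \<open>s\<close>-subsets that lie inside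
  one part is at least about \<open>2 / 2^s\<close>, its value for equal parts. Induction on \<open>s\<close> works without
  any smoothing: \<open>(s+1) (b choose s+1) = (b-s) (b choose s)\<close>, and the factors \<open>b - s\<close> and
  \<open>(b choose s)\<close> are ordered in the same way as \<open>c - s\<close> and \<open>(c choose s)\<close>, so Chebyshev's inequality
  bounds the sum of the two products from below. Compared with \<open>(b+c choose s)\<close>, the step from \<open>s\<close> to
  \<open>s + 1\<close> contributes half of a factor of at least \<open>1 - s/h\<close>, and these losses add up to \<open>s (s-1) / (2h)\<close>.
\<close>
lemma binomial_split_lower:
  fixes b c s S :: nat and h :: real
  assumes "s \<le> S" "2 * S \<le> b + c" "h > 0" "h + real S \<le> real (b + c)"
  shows "2 * (1 - real (s * (s - 1)) / (2 * h)) * real ((b + c) choose s)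
           \<le> 2 ^ s * (real (b choose s) + real (c choose s))"
  using assms(1)
proof (induction s)
  case (Suc s)
  let ?g = "real (b + c)" and ?a = "\<lambda>s. real (b choose s) + real (c choose s)"
  let ?x = "\<lambda>s. real (s * (s - 1)) / (2 * h)"
  have sS: "real s + 1 \<le> real S" using Suc.prems by linarith
  have g2: "2 * real S \<le> ?g" using assms(2) by linarith
  have cheb: "(real b - real c) * (real (b choose s) - real (c choose s)) \<ge> 0"
  proof (cases "b \<le> c")
    case True
    thus ?thesis using binomial_right_mono[of b c s] by (intro mult_nonpos_nonpos) auto
  next
    case False
    thus ?thesis using binomial_right_mono[of c b s] by (intro mult_nonneg_nonneg) auto
  qed
  have step: "(?g - 2 * real s) * ?a s \<le> 2 * (real (Suc s) * ?a (Suc s))"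
  proof -
    have "2 * (real (Suc s) * ?a (Suc s)) = 2 * ((real b - s) * (b choose s) + (real c - s) * (c choose s))"
      by (simp only: distrib_left Suc_times_binomial_real)
    moreover have "\<dots> = (?g - 2 * real s) * ?a s + (real b - real c) * (real (b choose s) - real (c choose s))"
      by (simp add: algebra_simps)
    ultimately show ?thesis using cheb by linarith
  qed
  have x: "?x (Suc s) = ?x s + real s / h"
    using assms(3) by (cases s) (simp_all add: field_simps)
  have h: "0 < ?g - real s" "h \<le> ?g - real s" using assms(3,4) sS by linarith+
  have "(1 - ?x (Suc s)) * (?g - real s) \<le> (1 - ?x s) * (?g - 2 * real s)"
  proof -
    have "real s / (?g - real s) \<le> real s / h" using h assms(3) by (intro divide_left_mono) auto
    hence "real s \<le> real s / h * (?g - real s)" using h by (simp add: pos_divide_le_eq)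
    moreover have "?x s * (?g - 2 * real s) \<le> ?x s * (?g - real s)"
      using assms(3) by (intro mult_left_mono) auto
    ultimately show ?thesis unfolding x by (simp add: algebra_simps)
  qed
  hence "(1 - ?x (Suc s)) * (?g - real s) * real ((b+c) choose s) \<le> (1 - ?x s) * (?g - 2 * real s) * real ((b+c) choose s)"
    by (rule mult_right_mono) auto
  hence "2 * ((1 - ?x (Suc s)) * (real (Suc s) * real ((b+c) choose Suc s))) \<le> (?g - 2 * real s) * (2 * (1 - ?x s) * real ((b+c) choose s))"
    unfolding Suc_times_binomial_real by (simp only: mult_ac)
  also have "\<dots> \<le> (?g - 2 * real s) * (2 ^ s * ?a s)"
    using Suc g2 sS by (intro mult_left_mono) auto
  also have "\<dots> = 2 ^ s * ((?g - 2 * real s) * ?a s)" by (rule mult.left_commute)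
  also have "\<dots> \<le> 2 ^ s * (2 * (real (Suc s) * ?a (Suc s)))"
    by (rule mult_left_mono[OF step]) simp
  finally have "real (Suc s) * (2 * (1 - ?x (Suc s)) * real ((b+c) choose Suc s)) \<le> real (Suc s) * (2 ^ Suc s * ?a (Suc s))"
    by (simp only: mult_ac power_Suc)
  thus ?case by (rule mult_left_le_imp_le) simp
qed simp

section \<open>Packings of blocks\<close>

definition blocks :: "'b set \<Rightarrow> nat \<Rightarrow> 'b set set" where
  "blocks G s = {X. X \<subseteq> G \<and> card X = s}"

text \<open>
  A set \<open>B\<close> is the union of a base set and some blocks of a packing exactly if it cuts none of the blocks.
\<close>
definition pure_blocks :: "'b set \<Rightarrow> nat \<Rightarrow> 'b set \<Rightarrow> 'b set set" where
  "pure_blocks G s B = {X \<in> blocks G s. X \<subseteq> B \<or> disjnt X B}"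

text \<open>
  A packing is a list, not a set of blocks: the blocks index the coordinates of a cube, and lists can be
  counted by adding one block at a time.
\<close>
definition packings :: "'b set set \<Rightarrow> nat \<Rightarrow> 'b set list set" where
  "packings W m = {V. length V = m \<and> set V \<subseteq> W \<and> sorted_wrt disjnt V}"

lemma finite_blocks: "finite G \<Longrightarrow> finite (blocks G s)"
  by (simp add: blocks_def)

lemma finite_pure_blocks: "finite G \<Longrightarrow> finite (pure_blocks G s B)"
  by (simp add: pure_blocks_def finite_blocks)

lemma card_blocks: "finite G \<Longrightarrow> card (blocks G s) = card G choose s"
  by (simp add: blocks_def n_subsets)

lemma card_pure_blocks:
  assumes "finite G" "s \<ge> 1"
  shows "card (pure_blocks G s B) = (card (G \<inter> B) choose s) + (card (G - B) choose s)"
proof -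
  have "pure_blocks G s B = blocks (G \<inter> B) s \<union> blocks (G - B) s"
    by (auto simp: pure_blocks_def blocks_def disjnt_def)
  moreover have "blocks (G \<inter> B) s \<inter> blocks (G - B) s = {}"
  proof -
    have "card X \<noteq> s" if "X \<subseteq> G \<inter> B" "X \<subseteq> G - B" for X
    proof -
      have "X = {}" using that by auto
      thus ?thesis using assms(2) by simp
    qed
    thus ?thesis unfolding blocks_def by blast
  qed
  ultimately show ?thesis
    using assms by (simp add: card_Un_disjoint finite_blocks card_blocks)
qed

lemma pure_blocks_lower:
  fixes G :: "'b set" and h :: real
  assumes "finite G" "s \<ge> 1" "2 * s \<le> card G" "h > 0" "h + real s \<le> real (card G)"
  shows "2 * (1 - real (s * (s - 1)) / (2 * h)) / 2 ^ s * real (card G choose s)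
           \<le> real (card (pure_blocks G s B))"
proof -
  have c: "card (G \<inter> B) + card (G - B) = card G"
    using assms(1) card_Int_Diff[of G B] by simp
  have "2 * (1 - real (s * (s - 1)) / (2 * h)) * real (card G choose s)
           \<le> 2 ^ s * real (card (pure_blocks G s B))"
    using binomial_split_lower[of s s "card (G \<inter> B)" "card (G - B)" h] assms
    by (simp add: c card_pure_blocks)
  thus ?thesis by (simp add: divide_le_eq mult_ac)
qed

lemma finite_packings: "finite W \<Longrightarrow> finite (packings W m)"
  by (rule finite_subset[OF _ finite_lists_length_eq[of W m]]) (auto simp: packings_def)

lemma packings_0 [simp]: "packings W 0 = {[]}"
  by (auto simp: packings_def)

lemma packings_mono: "W \<subseteq> W' \<Longrightarrow> packings W m \<subseteq> packings W' m"
  by (auto simp: packings_def)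

lemma card_packings_Suc:
  assumes "finite W"
  shows "card (packings W (Suc m)) = (\<Sum>V\<in>packings W m. card {X\<in>W. disjnt X (\<Union>(set V))})"
proof -
  let ?S = "SIGMA V:packings W m. {X\<in>W. disjnt X (\<Union>(set V))}"
  have "packings W (Suc m) = (\<lambda>(V, X). X # V) ` ?S"
  proof (intro equalityI subsetI)
    fix V assume "V \<in> packings W (Suc m)"
    then obtain X V' where "V = X # V'" "length V' = m" "X \<in> W" "set V' \<subseteq> W" 
      "sorted_wrt disjnt V'" "\<forall>Y\<in>set V'. disjnt X Y"
      by (cases V) (auto simp: packings_def)
    thus "V \<in> (\<lambda>(V, X). X # V) ` ?S" by (force simp: packings_def)
  qed (auto simp: packings_def)
  moreover have "inj_on (\<lambda>(V, X). X # V) ?S" by (auto simp: inj_on_def)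
  ultimately show ?thesis
    using assms by (simp add: card_image card_SigmaI finite_packings)
qed

lemma card_Union_packing:
  assumes "finite G" "V \<in> packings (blocks G s) m"
  shows "card (\<Union>(set V)) = s * m"
  using assms(2)
proof (induction m arbitrary: V)
  case (Suc m)
  then obtain X V' where V: "V = X # V'" "V' \<in> packings (blocks G s) m" "X \<in> blocks G s" 
      "\<forall>Y\<in>set V'. disjnt X Y"
    by (cases V) (auto simp: packings_def)
  have "\<Union>(set V') \<subseteq> G" using V(2) by (auto simp: packings_def blocks_def)
  hence "finite (\<Union>(set V'))" using assms(1) by (rule finite_subset)
  moreover have "finite X" using V(3) assms(1) by (auto simp: blocks_def intro: finite_subset)
  moreover have "X \<inter> \<Union>(set V') = {}" using V(4) by (auto simp: disjnt_def)
  ultimately have "card (\<Union>(set V)) = card X + card (\<Union>(set V'))"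
    by (simp add: V(1) card_Un_disjoint)
  thus ?case using Suc.IH[OF V(2)] V(3) by (simp add: blocks_def)
qed (simp add: packings_def)

lemma pure_blocks_avoiding:
  "{X \<in> pure_blocks G s B. disjnt X U} = pure_blocks (G - U) s B"
  by (auto simp: pure_blocks_def blocks_def disjnt_def)

lemma blocks_avoiding: "{X \<in> blocks G s. disjnt X U} = blocks (G - U) s"
  by (auto simp: blocks_def disjnt_def)

lemma pure_packings_subset: "packings (pure_blocks G s B) m \<subseteq> packings (blocks G s) m"
  by (rule packings_mono) (auto simp: pure_blocks_def)

lemma Union_packing_subset: "V \<in> packings (blocks G s) m \<Longrightarrow> \<Union>(set V) \<subseteq> G"
  by (auto simp: packings_def blocks_def)

lemma card_packings_blocks_Suc:
  assumes "finite G"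
  shows "card (packings (blocks G s) (Suc m)) = card (packings (blocks G s) m) * ((card G - s * m) choose s)"
proof -
  have "card {X \<in> blocks G s. disjnt X (\<Union>(set V))} = (card G - s * m) choose s"
    if "V \<in> packings (blocks G s) m" for V
    using card_Union_packing[OF assms that] Union_packing_subset[OF that] assms
    unfolding blocks_avoiding by (simp add: card_blocks card_Diff_subset finite_subset)
  thus ?thesis using assms by (simp add: card_packings_Suc finite_blocks)
qed

lemma pure_packings_Suc_lower:
  fixes q :: real
  assumes "finite G" "\<And>G'. G' \<subseteq> G \<Longrightarrow> card G' = card G - s * m \<Longrightarrow> q \<le> real (card (pure_blocks G' s B))"
  shows "q * real (card (packings (pure_blocks G s B) m)) \<le> real (card (packings (pure_blocks G s B) (Suc m)))"
proof -
  have "q \<le> real (card {X \<in> pure_blocks G s B. disjnt X (\<Union>(set V))})" 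
    if "V \<in> packings (pure_blocks G s B) m" for V
  proof -
    have V: "V \<in> packings (blocks G s) m" using that pure_packings_subset by blast
    show ?thesis
      unfolding pure_blocks_avoiding
      using card_Union_packing[OF assms(1) V] Union_packing_subset[OF V] assms(1)
      by (intro assms(2)) (auto simp: card_Diff_subset finite_subset)
  qed
  hence "real (card (packings (pure_blocks G s B) m)) * q \<le> (\<Sum>V\<in>packings (pure_blocks G s B) m. real (card {X \<in> pure_blocks G s B. disjnt X (\<Union>(set V))}))"
    by (rule sum_bounded_below)
  thus ?thesis by (simp add: card_packings_Suc finite_pure_blocks assms(1) mult.commute)
qed

text \<open>
  Choose the blocks one at a time: among the blocks that avoid those already chosen, a proportion \<open>\<rho>\<close> is
  not cut by \<open>B\<close>.
\<close>
lemma pure_packings_lower: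
  fixes \<rho> :: real
  assumes "finite G" "\<rho> \<ge> 0"
    and "\<And>G'. G' \<subseteq> G \<Longrightarrow> card G \<le> card G' + s * m \<Longrightarrow> \<rho> * real (card G' choose s) \<le> real (card (pure_blocks G' s B))"
  shows "\<rho> ^ m * real (card (packings (blocks G s) m)) \<le> real (card (packings (pure_blocks G s B) m))"
  using assms(3)
proof (induction m)
  case (Suc m)
  let ?N = "\<lambda>m. real (card (packings (pure_blocks G s B) m))" and ?b = "real ((card G - s * m) choose s)"
  have "\<rho> ^ Suc m * real (card (packings (blocks G s) (Suc m))) = (\<rho> * ?b) * (\<rho> ^ m * real (card (packings (blocks G s) m)))"
    by (simp add: card_packings_blocks_Suc assms(1))
  also have "\<dots> \<le> (\<rho> * ?b) * ?N m"
    using Suc.prems assms(2) by (intro mult_left_mono Suc.IH) auto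
  also have "\<dots> \<le> ?N (Suc m)"
  proof (rule pure_packings_Suc_lower[OF assms(1)])
    fix G' assume G': "G' \<subseteq> G" "card G' = card G - s * m"
    thus "\<rho> * ?b \<le> real (card (pure_blocks G' s B))" using Suc.prems[of G'] by simp
  qed
  finally show ?case .
next
  case 0
  show ?case by simp
qed

text \<open>
  If all members of a family \<open>S\<close> belong to one cube, then the set \<open>U = \<Union>S - \<Inter>S\<close> is a union of blocks
  of that cube.
\<close>
definition tiling_packings :: "'b set set \<Rightarrow> nat \<Rightarrow> 'b set \<Rightarrow> 'b set list set" where
  "tiling_packings W m U = {V \<in> packings W m. U \<subseteq> \<Union>(set V) \<and> (\<forall>X\<in>set V. X \<subseteq> U \<or> disjnt X U)}"

text \<open>
  Fix a point of \<open>U\<close>. Its block is one of at most \<open>u^(s-1)\<close> subsets of \<open>U\<close> and stands at one of at most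
  \<open>M\<close> positions; removing it leaves a packing with one block less that tiles the rest of \<open>U\<close>. After
  \<open>d\<close> rounds \<open>U\<close> is exhausted. Conversely every packing extends by a further block in at least \<open>q\<close>
  ways, and thus each of the \<open>d\<close> blocks inside \<open>U\<close> costs a factor \<open>M u^(s-1) / q\<close>. The count is done
  for arbitrary \<open>W\<close>, so that it can be made relative to the packings that do not cut a given set.
\<close>
lemma tiling_packings_upper:
  fixes q :: real
  assumes "finite G" "W \<subseteq> blocks G s" "s \<ge> 1" "q \<ge> 0"
    and ext: "\<And>j. j < M \<Longrightarrow> q * real (card (packings W j)) \<le> real (card (packings W (Suc j)))"
  shows "U \<subseteq> G \<Longrightarrow> card U = d * s \<Longrightarrow> card U \<le> u \<Longrightarrow> m \<le> M \<Longrightarrow> 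
    q ^ d * real (card (tiling_packings W m U)) \<le> (real M * real u ^ (s - 1)) ^ d * real (card (packings W m))"
proof (induction d arbitrary: U m)
  case 0
  have fW: "finite W" using assms(1,2) finite_blocks finite_subset by blast
  have "card (tiling_packings W m U) \<le> card (packings W m)"
    by (rule card_mono[OF finite_packings[OF fW]]) (auto simp: tiling_packings_def)
  thus ?case by simp
next
  case (Suc d)
  have fW: "finite W" using assms(1,2) finite_blocks finite_subset by blast
  have fU: "finite U" using Suc.prems(1) assms(1) finite_subset by blast
  have "card U > 0" using Suc.prems(2) assms(3) by simp
  then obtain x where x: "x \<in> U" by (metis card_gt_0_iff ex_in_conv)
  show ?case
  proof (cases m)
    case 0
    hence "tiling_packings W m U = {}" using x by (auto simp: tiling_packings_def packings_def)
    thus ?thesis using Suc.prems by simp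
  next
    case (Suc n)
    let ?Ws = "{X. X \<subseteq> U \<and> x \<in> X \<and> card X = s}"
    let ?ins = "\<lambda>i X V. take i V @ X # drop i V"
    let ?c = "real M * real u ^ (s - 1)"
    have fWs: "finite ?Ws" using fU by simp
    have cWs: "card ?Ws \<le> u ^ (s - 1)"
    proof -
      have "?Ws \<subseteq> insert x ` blocks (U - {x}) (s - 1)"
      proof
        fix X assume X: "X \<in> ?Ws"
        hence "finite X" using fU finite_subset by blast
        hence "X - {x} \<in> blocks (U - {x}) (s - 1)" "X = insert x (X - {x})" using X by (auto simp: blocks_def)
        thus "X \<in> insert x ` blocks (U - {x}) (s - 1)" by blast
      qed
      hence "card ?Ws \<le> card (blocks (U - {x}) (s - 1))"
        using fU by (meson finite_Diff finite_blocks surj_card_le)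
      also have "\<dots> = (card U - 1) choose (s - 1)" using fU x by (simp add: card_blocks)
      also have "\<dots> \<le> (card U - 1) ^ (s - 1)"
      proof (cases "s - 1 \<le> card U - 1")
        case True thus ?thesis by (rule binomial_le_pow)
      qed (simp add: binomial_eq_0)
      also have "\<dots> \<le> u ^ (s - 1)" using Suc.prems by (intro power_mono) auto
      finally show ?thesis .
    qed
    have sub: "tiling_packings W m U \<subseteq> (\<Union>i\<in>{..<m}. \<Union>X\<in>?Ws. ?ins i X ` tiling_packings W n (U - X))"
    proof
      fix V assume V: "V \<in> tiling_packings W m U"
      have len: "length V = m" and VW: "set V \<subseteq> W" and dj: "sorted_wrt disjnt V" and UV: "U \<subseteq> \<Union>(set V)"
        and pure: "\<forall>X\<in>set V. X \<subseteq> U \<or> disjnt X U"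
        using V by (auto simp: tiling_packings_def packings_def)
      obtain X where X: "X \<in> set V" "x \<in> X" using x UV by blast
      then obtain V1 V2 where V12: "V = V1 @ X # V2" by (meson split_list)
      define V' where "V' = V1 @ V2"
      have XU: "X \<in> ?Ws" using X pure x VW assms(2) by (auto simp: disjnt_def blocks_def)
      have dX: "\<forall>Y\<in>set V'. disjnt X Y" 
        using dj by (auto simp: V12 V'_def sorted_wrt_append disjnt_def)
      have "sorted_wrt disjnt V'" using dj by (auto simp: V12 V'_def sorted_wrt_append)
      moreover have setV: "set V = insert X (set V')" by (simp add: V12 V'_def)
      moreover have "length V' = n" using len Suc by (simp add: V12 V'_def)
      ultimately have "V' \<in> tiling_packings W n (U - X)"
        using VW UV pure dX unfolding setV by (auto simp: tiling_packings_def packings_def disjnt_def)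
      moreover have "V = ?ins (length V1) X V'" "length V1 < m" using len by (simp_all add: V12 V'_def)
      ultimately show "V \<in> (\<Union>i\<in>{..<m}. \<Union>X\<in>?Ws. ?ins i X ` tiling_packings W n (U - X))"
        using XU by blast
    qed
    have fT: "finite (tiling_packings W k U')" for k U'
      by (rule finite_subset[OF _ finite_packings[OF fW]]) (auto simp: tiling_packings_def)
    have "card (tiling_packings W m U) \<le> card (\<Union>i\<in>{..<m}. \<Union>X\<in>?Ws. ?ins i X ` tiling_packings W n (U - X))"
      using fWs fT by (intro card_mono[OF _ sub]) auto
    also have "\<dots> \<le> (\<Sum>i\<in>{..<m}. card (\<Union>X\<in>?Ws. ?ins i X ` tiling_packings W n (U - X)))"
      by (rule card_UN_le) simp
    also have "\<dots> \<le> (\<Sum>i\<in>{..<m}. \<Sum>X\<in>?Ws. card (?ins i X ` tiling_packings W n (U - X)))"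
      by (intro sum_mono card_UN_le fWs)
    also have "\<dots> \<le> (\<Sum>i\<in>{..<m}. \<Sum>X\<in>?Ws. card (tiling_packings W n (U - X)))"
      by (intro sum_mono card_image_le fT)
    finally have le: "real (card (tiling_packings W m U)) \<le> real m * (\<Sum>X\<in>?Ws. real (card (tiling_packings W n (U - X))))"
      by (simp flip: of_nat_sum of_nat_mult)
    have IH: "q ^ d * real (card (tiling_packings W n (U - X))) \<le> ?c ^ d * real (card (packings W n))"
      if "X \<in> ?Ws" for X
    proof (rule Suc.IH)
      have "card (U - X) = card U - s" using that fU by (auto simp: card_Diff_subset finite_subset)
      thus "card (U - X) = d * s" "card (U - X) \<le> u" using Suc.prems by auto
    qed (use Suc.prems Suc in auto)
    have "q ^ Suc d * real (card (tiling_packings W m U)) \<le> q * (q ^ d * (real m * (\<Sum>X\<in>?Ws. real (card (tiling_packings W n (U - X))))))"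
      using le assms(4) by (simp add: mult.assoc mult_left_mono)
    also have "\<dots> = q * real m * (\<Sum>X\<in>?Ws. q ^ d * real (card (tiling_packings W n (U - X))))"
      by (simp add: sum_distrib_left mult_ac)
    also have "\<dots> \<le> q * real m * (\<Sum>X\<in>?Ws. ?c ^ d * real (card (packings W n)))"
      using assms(4) by (intro mult_left_mono sum_mono IH) auto
    also have "\<dots> = (real m * real (card ?Ws)) * ?c ^ d * (q * real (card (packings W n)))"
      by simp
    also have "\<dots> \<le> ?c * ?c ^ d * (q * real (card (packings W n)))"
    proof (intro mult_right_mono mult_mono)
      show "real (card ?Ws) \<le> real u ^ (s - 1)" using cWs by (simp flip: of_nat_power)
    qed (use Suc.prems assms(4) in auto)
    also have "\<dots> \<le> ?c * ?c ^ d * real (card (packings W m))"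
      unfolding Suc using Suc Suc.prems by (intro mult_left_mono ext) auto
    finally show ?thesis by simp
  qed
qed

section \<open>Cubes spanned by packings\<close>

definition cubes :: "'b set \<Rightarrow> nat \<Rightarrow> nat \<Rightarrow> ('b set list \<times> 'b set) set" where
  "cubes G s m = (SIGMA V:packings (blocks G s) m. Pow (G - \<Union>(set V)))"

text \<open>
  Coordinates run through \<open>{1..m}\<close>, the ground set of the Boolean lattice in the definition of
  \<open>La_star\<close>, while list positions start at \<open>0\<close>; hence the shift by one.
\<close>
definition cube_point :: "'b set list \<times> 'b set \<Rightarrow> nat set \<Rightarrow> 'b set" where
  "cube_point Q X = snd Q \<union> (\<Union>i\<in>X. fst Q ! (i - 1))"

definition cube :: "'b set list \<times> 'b set \<Rightarrow> 'b set set" where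
  "cube Q = cube_point Q ` Pow {1..length (fst Q)}"

lemma finite_cubes: "finite G \<Longrightarrow> finite (cubes G s m)"
  by (simp add: cubes_def finite_packings finite_blocks)

lemma card_cubes:
  assumes "finite G" "s * m \<le> card G"
  shows "card (cubes G s m) = card (packings (blocks G s) m) * 2 ^ (card G - s * m)"
proof -
  have "card (Pow (G - \<Union>(set V))) = 2 ^ (card G - s * m)" if "V \<in> packings (blocks G s) m" for V
    using card_Union_packing[OF assms(1) that] Union_packing_subset[OF that] assms(1)
    by (simp only: card_Pow finite_Diff card_Diff_subset finite_subset)
  thus ?thesis using assms(1) by (simp add: cubes_def card_SigmaI finite_packings finite_blocks)
qed

lemma cubes_length: "Q \<in> cubes G s m \<Longrightarrow> length (fst Q) = m"
  by (auto simp: cubes_def packings_def)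

lemma cubes_nth_disjoint:
  assumes "Q \<in> cubes G s m" "i \<in> {1..m}" "j \<in> {1..m}" "i \<noteq> j"
  shows "fst Q ! (i - 1) \<inter> fst Q ! (j - 1) = {}"
proof -
  have len: "length (fst Q) = m" using assms(1) by (rule cubes_length)
  have "sorted_wrt disjnt (fst Q)" using assms(1) by (auto simp: cubes_def packings_def)
  hence *: "fst Q ! a \<inter> fst Q ! b = {}" if "a < b" "b < m" for a b
    using that len by (auto simp: sorted_wrt_iff_nth_less disjnt_def)
  show ?thesis
    using *[of "i - 1" "j - 1"] *[of "j - 1" "i - 1"] assms(2-4) by (cases "i < j") (auto simp: Int_commute)
qed

lemma cubes_nth_block:
  assumes "Q \<in> cubes G s m" "i \<in> {1..m}"
  shows "fst Q ! (i - 1) \<in> set (fst Q)" "fst Q ! (i - 1) \<in> blocks G s" "snd Q \<inter> fst Q ! (i - 1) = {}"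
proof -
  show 1: "fst Q ! (i - 1) \<in> set (fst Q)"
    using assms cubes_length[OF assms(1)] by (intro nth_mem) auto
  show "fst Q ! (i - 1) \<in> blocks G s" "snd Q \<inter> fst Q ! (i - 1) = {}"
    using 1 assms(1) by (fastforce simp: cubes_def packings_def)+
qed

lemma mem_cube_point_iff:
  assumes "Q \<in> cubes G s m" "i \<in> {1..m}" "z \<in> fst Q ! (i - 1)" "X \<subseteq> {1..m}"
  shows "z \<in> cube_point Q X \<longleftrightarrow> i \<in> X"
  using cubes_nth_disjoint[OF assms(1,2)] cubes_nth_block(3)[OF assms(1,2)] assms(3,4)
  unfolding cube_point_def by blast

lemma cube_point_subset_iff:
  assumes "Q \<in> cubes G s m" "s \<ge> 1" "X \<subseteq> {1..m}" "Y \<subseteq> {1..m}"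
  shows "cube_point Q X \<subseteq> cube_point Q Y \<longleftrightarrow> X \<subseteq> Y"
proof
  assume sub: "cube_point Q X \<subseteq> cube_point Q Y"
  show "X \<subseteq> Y"
  proof
    fix i assume i: "i \<in> X"
    have "fst Q ! (i - 1) \<noteq> {}" 
      using cubes_nth_block(2)[OF assms(1), of i] i assms(2,3) by (auto simp: blocks_def)
    then obtain z where z: "z \<in> fst Q ! (i - 1)" by blast
    thus "i \<in> Y" using sub i mem_cube_point_iff[OF assms(1) _ z] assms(3,4) by blast
  qed
qed (auto simp: cube_point_def)

lemma cube_point_psubset_iff:
  assumes "Q \<in> cubes G s m" "s \<ge> 1" "X \<subseteq> {1..m}" "Y \<subseteq> {1..m}"
  shows "cube_point Q X \<subset> cube_point Q Y \<longleftrightarrow> X \<subset> Y"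
  using cube_point_subset_iff[OF assms(1,2)] assms(3,4) by (simp add: less_le_not_le)

lemma inj_on_cube_point:
  assumes "Q \<in> cubes G s m" "s \<ge> 1"
  shows "inj_on (cube_point Q) (Pow {1..m})"
  using cube_point_subset_iff[OF assms] by (auto simp: inj_on_def) (metis equalityE subset_antisym subsetD)+

lemma mem_cubeD:
  assumes "Q \<in> cubes G s m" "B \<in> cube Q"
  shows "B \<subseteq> G" "fst Q \<in> packings (pure_blocks G s B) m" "snd Q = B - \<Union>(set (fst Q))"
proof -
  have len: "length (fst Q) = m" using assms(1) by (rule cubes_length)
  obtain X where X: "X \<subseteq> {1..m}" "B = cube_point Q X" using assms(2) len by (auto simp: cube_def)
  have base: "snd Q \<subseteq> G" "snd Q \<inter> \<Union>(set (fst Q)) = {}" using assms(1) by (auto simp: cubes_def)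
  have bl: "\<And>i. i \<in> X \<Longrightarrow> fst Q ! (i - 1) \<in> set (fst Q) \<and> fst Q ! (i - 1) \<subseteq> G"
    using cubes_nth_block(1,2)[OF assms(1)] X(1) unfolding blocks_def by blast
  show "B \<subseteq> G" unfolding X(2) cube_point_def using base bl by blast
  show "snd Q = B - \<Union>(set (fst Q))" unfolding X(2) cube_point_def using base bl by blast
  have "W \<subseteq> B \<or> disjnt W B" if W: "W \<in> set (fst Q)" for W
  proof -
    obtain j where "j < m" "W = fst Q ! j" using W len by (auto simp: in_set_conv_nth)
    hence i: "Suc j \<in> {1..m}" "W = fst Q ! (Suc j - 1)" by auto
    show ?thesis
      unfolding disjnt_iff X(2) using mem_cube_point_iff[OF assms(1) i(1) _ X(1)] i(2) by blast
  qed
  thus "fst Q \<in> packings (pure_blocks G s B) m"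
    using assms(1) by (auto simp: cubes_def packings_def pure_blocks_def)
qed

lemma mem_cubeI:
  assumes "B \<subseteq> G" "V \<in> packings (pure_blocks G s B) m"
  shows "(V, B - \<Union>(set V)) \<in> cubes G s m" "B \<in> cube (V, B - \<Union>(set V))"
proof -
  show 1: "(V, B - \<Union>(set V)) \<in> cubes G s m"
    using assms pure_packings_subset[of G s B m] by (auto simp: cubes_def)
  have V: "length V = m" "\<And>W. W \<in> set V \<Longrightarrow> W \<subseteq> B \<or> disjnt W B" 
    using assms(2) by (auto simp: packings_def pure_blocks_def)
  have "B = cube_point (V, B - \<Union>(set V)) {i \<in> {1..m}. V ! (i - 1) \<subseteq> B}"
  proof (intro equalityI subsetI)
    fix z assume z: "z \<in> B"
    show "z \<in> cube_point (V, B - \<Union>(set V)) {i \<in> {1..m}. V ! (i - 1) \<subseteq> B}"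
    proof (cases "z \<in> \<Union>(set V)")
      case True
      then obtain j where j: "j < m" "z \<in> V ! j" using V(1) by (auto simp: in_set_conv_nth)
      have "V ! j \<in> set V" using j(1) V(1) by simp
      from V(2)[OF this] have "V ! j \<subseteq> B" using j(2) z unfolding disjnt_iff by blast
      hence "Suc j \<in> {i \<in> {1..m}. V ! (i - 1) \<subseteq> B}" using j by auto
      thus ?thesis using j unfolding cube_point_def by (intro UnI2 UN_I[of "Suc j"]) auto
    qed (use z in \<open>auto simp: cube_point_def\<close>)
  qed (auto simp: cube_point_def)
  moreover have "{i \<in> {1..m}. V ! (i - 1) \<subseteq> B} \<in> Pow {1..m}" by auto
  ultimately show "B \<in> cube (V, B - \<Union>(set V))" unfolding cube_def fst_conv V(1) by (rule image_eqI)
qed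

text \<open>
  Once the packing is known, the base of a cube through \<open>B\<close> can only be \<open>B\<close> minus all blocks.
\<close>
lemma card_cubes_through:
  assumes "finite G" "B \<subseteq> G"
  shows "card {Q \<in> cubes G s m. B \<in> cube Q} = card (packings (pure_blocks G s B) m)"
proof (rule bij_betw_same_card[of fst])
  show "bij_betw fst {Q \<in> cubes G s m. B \<in> cube Q} (packings (pure_blocks G s B) m)"
  proof (rule bij_betw_byWitness[of _ "\<lambda>V. (V, B - \<Union>(set V))"])
    show "\<forall>Q\<in>{Q \<in> cubes G s m. B \<in> cube Q}. (fst Q, B - \<Union>(set (fst Q))) = Q"
      using mem_cubeD(3) by (metis (mono_tags, lifting) mem_Collect_eq prod.collapse)
    show "fst ` {Q \<in> cubes G s m. B \<in> cube Q} \<subseteq> packings (pure_blocks G s B) m"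
      using mem_cubeD(2) by blast
  qed (use mem_cubeI[OF assms(2)] in auto)
qed

lemma card_cubes_containing:
  assumes "finite G" "B \<in> S"
  shows "card {Q \<in> cubes G s m. S \<subseteq> cube Q} \<le> card (tiling_packings (pure_blocks G s B) m (\<Union>S - \<Inter>S))"
proof (rule card_inj_on_le[of fst])
  show "inj_on fst {Q \<in> cubes G s m. S \<subseteq> cube Q}"
  proof (rule inj_onI)
    fix Q Q' assume "Q \<in> {Q \<in> cubes G s m. S \<subseteq> cube Q}" "Q' \<in> {Q \<in> cubes G s m. S \<subseteq> cube Q}" "fst Q = fst Q'"
    moreover from this have "snd Q = snd Q'"
      using mem_cubeD(3)[of Q G s m B] mem_cubeD(3)[of Q' G s m B] assms(2) by (simp add: subset_iff)
    ultimately show "Q = Q'" by (simp add: prod_eq_iff)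
  qed
  show "finite (tiling_packings (pure_blocks G s B) m (\<Union>S - \<Inter>S))"
    by (rule finite_subset[OF _ finite_packings[OF finite_pure_blocks[OF assms(1)]]]) (auto simp: tiling_packings_def)
  show "fst ` {Q \<in> cubes G s m. S \<subseteq> cube Q} \<subseteq> tiling_packings (pure_blocks G s B) m (\<Union>S - \<Inter>S)"
  proof (rule image_subsetI)
    fix Q assume "Q \<in> {Q \<in> cubes G s m. S \<subseteq> cube Q}"
    hence Q: "Q \<in> cubes G s m" "S \<subseteq> cube Q" by auto
    have P: "\<And>C. C \<in> S \<Longrightarrow> fst Q \<in> packings (pure_blocks G s C) m \<and> snd Q = C - \<Union>(set (fst Q))"
      using mem_cubeD(2,3)[OF Q(1)] Q(2) by blast
    have "\<Union>S - \<Inter>S \<subseteq> \<Union>(set (fst Q))" using P by blast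
    moreover have "W \<subseteq> \<Union>S - \<Inter>S \<or> disjnt W (\<Union>S - \<Inter>S)" if "W \<in> set (fst Q)" for W
    proof -
      have "\<And>C. C \<in> S \<Longrightarrow> W \<subseteq> C \<or> disjnt W C" 
        using P that by (auto simp: packings_def pure_blocks_def)
      thus ?thesis unfolding disjnt_iff by blast
    qed
    ultimately show "fst Q \<in> tiling_packings (pure_blocks G s B) m (\<Union>S - \<Inter>S)"
      using P[OF assms(2)] by (simp add: tiling_packings_def)
  qed
qed

lemma card_difference_in_cube:
  assumes "finite G" "Q \<in> cubes G s m" "\<X> \<subseteq> Pow {1..m}" "\<X> \<noteq> {}"
  shows "card (\<Union>(cube_point Q ` \<X>) - \<Inter>(cube_point Q ` \<X>)) = s * card (\<Union>\<X> - \<Inter>\<X>)"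
proof -
  let ?I = "\<Union>\<X> - \<Inter>\<X>"
  have I: "?I \<subseteq> {1..m}" using assms(3) by blast
  have iff: "\<And>i z X. i \<in> {1..m} \<Longrightarrow> z \<in> fst Q ! (i - 1) \<Longrightarrow> X \<in> \<X> \<Longrightarrow> z \<in> cube_point Q X \<longleftrightarrow> i \<in> X"
    using mem_cube_point_iff[OF assms(2)] assms(3) by blast
  have "\<Union>(cube_point Q ` \<X>) - \<Inter>(cube_point Q ` \<X>) = (\<Union>i\<in>?I. fst Q ! (i - 1))"
  proof (intro equalityI subsetI)
    fix z assume z: "z \<in> \<Union>(cube_point Q ` \<X>) - \<Inter>(cube_point Q ` \<X>)"
    then obtain X Y where XY: "X \<in> \<X>" "z \<in> cube_point Q X" "Y \<in> \<X>" "z \<notin> cube_point Q Y" by blast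
    then obtain i where i: "i \<in> X" "z \<in> fst Q ! (i - 1)" unfolding cube_point_def by blast
    have "i \<in> {1..m}" using i(1) XY(1) assms(3) by blast
    hence "i \<notin> Y" using iff i XY by blast
    thus "z \<in> (\<Union>i\<in>?I. fst Q ! (i - 1))" using i XY by blast
  next
    fix z assume "z \<in> (\<Union>i\<in>?I. fst Q ! (i - 1))"
    then obtain i where i: "i \<in> ?I" "z \<in> fst Q ! (i - 1)" by blast
    thus "z \<in> \<Union>(cube_point Q ` \<X>) - \<Inter>(cube_point Q ` \<X>)" using iff[of i z] I by blast
  qed
  moreover have "card (\<Union>i\<in>?I. fst Q ! (i - 1)) = (\<Sum>i\<in>?I. card (fst Q ! (i - 1)))"
  proof (rule card_UN_disjoint)
    show "finite ?I" using I finite_subset by blast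
    show "\<forall>i\<in>?I. finite (fst Q ! (i - 1))"
      using cubes_nth_block(2)[OF assms(2)] I assms(1) finite_subset unfolding blocks_def by blast
    show "\<forall>i\<in>?I. \<forall>j\<in>?I. i \<noteq> j \<longrightarrow> fst Q ! (i - 1) \<inter> fst Q ! (j - 1) = {}"
      using cubes_nth_disjoint[OF assms(2)] I by blast
  qed
  moreover have "(\<Sum>i\<in>?I. card (fst Q ! (i - 1))) = (\<Sum>i\<in>?I. s)"
    using cubes_nth_block(2)[OF assms(2)] I by (intro sum.cong) (auto simp: blocks_def)
  ultimately show ?thesis by simp
qed

text \<open>
  Reading off coordinates turns an embedding of \<open>D\<close> into a cube into an embedding of \<open>D\<close> into the
  lattice on the \<open>m\<close> blocks, whose diameter counts the blocks in which the images differ.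
\<close>
lemma d_star_le_blocks:
  assumes "finite G" "Q \<in> cubes G s m" "s \<ge> 1" "D \<noteq> {}" "f ` D \<subseteq> cube Q"
    and f: "inj_on f D" "\<forall>x\<in>D. \<forall>y\<in>D. f x \<subset> f y \<longleftrightarrow> (x, y) \<in> r \<and> x \<noteq> y"
  obtains d where "card (\<Union>(f ` D) - \<Inter>(f ` D)) = d * s" "d_star D r \<le> d" "d \<le> m"
proof -
  have len: "length (fst Q) = m" using assms(2) by (rule cubes_length)
  have "\<forall>x\<in>D. \<exists>X. X \<subseteq> {1..m} \<and> f x = cube_point Q X" using assms(5) len unfolding cube_def by blast
  then obtain \<phi> where \<phi>: "\<And>x. x \<in> D \<Longrightarrow> \<phi> x \<subseteq> {1..m} \<and> f x = cube_point Q (\<phi> x)" by metis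
  let ?d = "card (\<Union>(\<phi> ` D) - \<Inter>(\<phi> ` D))"
  have im: "f ` D = cube_point Q ` (\<phi> ` D)" using \<phi> by (auto simp: image_image)
  have "induced_embedding D r (Pow {1..m}) \<phi>"
    unfolding induced_embedding_def
  proof (intro conjI)
    show "inj_on \<phi> D" using f(1) \<phi> by (metis (mono_tags, lifting) inj_on_def)
    show "\<forall>x\<in>D. \<forall>y\<in>D. \<phi> x \<subset> \<phi> y \<longleftrightarrow> (x, y) \<in> r \<and> x \<noteq> y"
      using f(2) \<phi> cube_point_psubset_iff[OF assms(2,3)] by metis
  qed (use \<phi> in auto)
  hence "diam (\<phi> ` D) \<in> {diam (\<phi> ` D) | \<phi> n. induced_embedding D r (Pow {1..n}) \<phi>}" by blast
  hence 1: "d_star D r \<le> ?d"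
    unfolding d_star_def by (metis (no_types, lifting) cInf_lower bdd_below_bot diam_def)
  have "\<Union>(\<phi> ` D) - \<Inter>(\<phi> ` D) \<subseteq> {1..m}" using \<phi> by blast
  hence 2: "?d \<le> m" using card_mono[of "{1..m}"] by fastforce
  have "card (\<Union>(f ` D) - \<Inter>(f ` D)) = ?d * s"
    unfolding im using card_difference_in_cube[OF assms(1,2), of "\<phi> ` D"] \<phi> assms(4) by (auto simp: mult.commute)
  thus ?thesis using that 1 2 by blast
qed

lemma copy_in_dense_subcube:
  assumes "Q \<in> cubes G s m" "s \<ge> 1" "F \<subseteq> cube Q" "La_star m P r < card F"
  obtains f where "f ` P \<subseteq> F" "inj_on f P" "\<forall>x\<in>P. \<forall>y\<in>P. f x \<subset> f y \<longleftrightarrow> (x, y) \<in> r \<and> x \<noteq> y"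
proof -
  have len: "length (fst Q) = m" using assms(1) by (rule cubes_length)
  define F' where "F' = {X \<in> Pow {1..m}. cube_point Q X \<in> F}"
  have F': "F' \<subseteq> Pow {1..m}" by (auto simp: F'_def)
  have "cube_point Q ` F' = F" using assms(3) len by (auto simp: F'_def cube_def)
  hence "card F' = card F" 
    using card_image[of "cube_point Q" F'] inj_on_subset[OF inj_on_cube_point[OF assms(1,2)] F'] by simp
  have "induced_copies P r F' \<noteq> {}"
  proof
    assume "induced_copies P r F' = {}"
    hence mem: "card F' \<in> {card F | F. F \<subseteq> Pow {1..m} \<and> induced_copies P r F = {}}" using F' by blast
    have "{card F | F. F \<subseteq> Pow {1..m} \<and> induced_copies P r F = {}} \<subseteq> card ` Pow (Pow {1..m})" by blast
    hence "finite {card F | F. F \<subseteq> Pow {1..m} \<and> induced_copies P r F = {}}" 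
      by (rule finite_subset) auto
    hence "card F' \<le> La_star m P r" unfolding La_star_def using mem by (rule Max_ge)
    thus False using assms(4) \<open>card F' = card F\<close> by simp
  qed
  then obtain g where g: "g ` P \<subseteq> F'" "inj_on g P" "\<forall>x\<in>P. \<forall>y\<in>P. g x \<subset> g y \<longleftrightarrow> (x, y) \<in> r \<and> x \<noteq> y"
    by (auto simp: induced_copies_def induced_embedding_def)
  have gP: "\<And>x. x \<in> P \<Longrightarrow> g x \<subseteq> {1..m}" using g(1) F' by blast
  show ?thesis
  proof (rule that[of "cube_point Q \<circ> g"])
    show "(cube_point Q \<circ> g) ` P \<subseteq> F" using g(1) by (auto simp: F'_def)
    show "inj_on (cube_point Q \<circ> g) P"
      using g(1,2) F' inj_on_cube_point[OF assms(1,2)] by (meson comp_inj_on inj_on_subset subset_trans)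
    show "\<forall>x\<in>P. \<forall>y\<in>P. (cube_point Q \<circ> g) x \<subset> (cube_point Q \<circ> g) y \<longleftrightarrow> (x, y) \<in> r \<and> x \<noteq> y"
      using g(3) gP cube_point_psubset_iff[OF assms(1,2)] by simp
  qed
qed

section \<open>Averaging over cubes\<close>

lemma sum_card_swap:
  assumes "finite A" "finite B"
  shows "(\<Sum>x\<in>A. card {y \<in> B. R x y}) = (\<Sum>y\<in>B. card {x \<in> A. R x y})"
  using sum_multicount_gen[OF assms, of R "\<lambda>y. card {x \<in> A. R x y}"] by simp

text \<open>
  Sum over all cubes. Each forbidden set \<open>S \<in> \<S>\<close> is charged to all its members; since the charge to \<open>B\<close>
  is at most a \<open>\<theta>\<close>-fraction of the cubes through \<open>B\<close>, the members of \<open>F\<close> outnumber the forbidden sets on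
  average.
\<close>
lemma exists_dense_cube:
  fixes L \<theta> a :: real
  assumes "finite G" "F \<subseteq> Pow G"
    and \<S>: "finite \<S>" "\<And>S. S \<in> \<S> \<Longrightarrow> S \<noteq> {} \<and> S \<subseteq> F"
    and light: "\<And>B. B \<in> F \<Longrightarrow> (\<Sum>S | S \<in> \<S> \<and> B \<in> S. real (card {Q \<in> cubes G s m. S \<subseteq> cube Q}))
                  \<le> \<theta> * real (card {Q \<in> cubes G s m. B \<in> cube Q})"
    and L: "\<And>B. B \<in> F \<Longrightarrow> L \<le> real (card {Q \<in> cubes G s m. B \<in> cube Q})"
    and "\<theta> \<le> 1" and large: "a * real (card (cubes G s m)) < (1 - \<theta>) * real (card F) * L"
  obtains Q where "Q \<in> cubes G s m" 
    "a + real (card {S \<in> \<S>. S \<subseteq> cube Q}) < real (card (F \<inter> cube Q))"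
proof -
  let ?C = "cubes G s m"
  let ?N = "\<lambda>S. real (card {Q \<in> ?C. S \<subseteq> cube Q})" and ?n = "\<lambda>B. real (card {Q \<in> ?C. B \<in> cube Q})"
  have fC: "finite ?C" using assms(1) by (rule finite_cubes)
  have fF: "finite F" using assms(1,2) finite_subset by blast
  have "\<exists>Q\<in>?C. a + real (card {S \<in> \<S>. S \<subseteq> cube Q}) < real (card (F \<inter> cube Q))"
  proof (rule ccontr)
    assume "\<not> ?thesis"
    hence le: "real (card {B \<in> F. B \<in> cube Q}) \<le> a + real (card {S \<in> \<S>. S \<subseteq> cube Q})" if "Q \<in> ?C" for Q
      using that by (force simp: Int_def)
    have "(\<Sum>B\<in>F. ?n B) = (\<Sum>Q\<in>?C. real (card {B \<in> F. B \<in> cube Q}))"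
      using sum_card_swap[OF fC fF, of "\<lambda>Q B. B \<in> cube Q"] by (simp flip: of_nat_sum)
    also have "\<dots> \<le> (\<Sum>Q\<in>?C. a + real (card {S \<in> \<S>. S \<subseteq> cube Q}))" by (rule sum_mono) (rule le)
    also have "\<dots> = a * real (card ?C) + (\<Sum>S\<in>\<S>. ?N S)"
      using sum_card_swap[OF fC \<S>(1), of "\<lambda>Q S. S \<subseteq> cube Q"] by (simp add: sum.distrib mult.commute flip: of_nat_sum)
    also have "(\<Sum>S\<in>\<S>. ?N S) \<le> (\<Sum>S\<in>\<S>. \<Sum>B | B \<in> F \<and> B \<in> S. ?N S)"
    proof (rule sum_mono)
      fix S assume "S \<in> \<S>"
      then obtain B where "B \<in> F" "B \<in> S" using \<S>(2) by blast
      hence "card {B. B \<in> F \<and> B \<in> S} > 0" using fF by (auto simp: card_gt_0_iff)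
      thus "?N S \<le> (\<Sum>B | B \<in> F \<and> B \<in> S. ?N S)" by (simp add: mult_le_cancel_right1)
    qed
    also have "\<dots> = (\<Sum>B\<in>F. \<Sum>S | S \<in> \<S> \<and> B \<in> S. ?N S)"
      by (rule sum.swap_restrict[OF \<S>(1) fF])
    also have "\<dots> \<le> (\<Sum>B\<in>F. \<theta> * ?n B)" by (rule sum_mono) (rule light)
    finally have "(1 - \<theta>) * (\<Sum>B\<in>F. ?n B) \<le> a * real (card ?C)"
      by (simp add: algebra_simps flip: sum_distrib_left)
    moreover have "(1 - \<theta>) * (real (card F) * L) \<le> (1 - \<theta>) * (\<Sum>B\<in>F. ?n B)"
      using assms(7) sum_bounded_below[of F L ?n] L by (intro mult_left_mono) auto
    ultimately show False using large by (simp add: mult.assoc)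
  qed
  thus ?thesis using that by blast
qed

section \<open>Balanced collections of copies\<close>

lemma family_degree_insert:
  assumes "finite H" "A \<notin> H"
  shows "family_degree (insert A H) S = family_degree H S + (if S \<subseteq> A then 1 else 0)"
proof -
  have "{A' \<in> insert A H. S \<subseteq> A'} = (if S \<subseteq> A then insert A {A' \<in> H. S \<subseteq> A'} else {A' \<in> H. S \<subseteq> A'})" by auto
  thus ?thesis using assms by (simp add: family_degree_def)
qed

lemma card_induced_copy: "A \<in> induced_copies P r F \<Longrightarrow> card A = card P"
  by (auto simp: induced_copies_def induced_embedding_def card_image)

lemma induced_copy_subset: "A \<in> induced_copies P r F \<Longrightarrow> A \<subseteq> F"
  by (auto simp: induced_copies_def induced_embedding_def)

text \<open>
  Any largest collection \<open>H\<close> that respects the degree bounds has at least \<open>\<tau>\<close> members. Otherwise the sets of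
  degree at least \<open>K D^(|P|-1)\<close> form at most a sixteenth of \<open>F\<close>. For the other sets \<open>B\<close> the degrees of
  all \<open>S\<close> containing \<open>B\<close> add up to at most \<open>2^|P| K D^(|P|-1)\<close>, since a copy has \<open>2^|P|\<close> subsets; weighted
  with the \<open>\<eta> D^(1-|S|)\<close> of \<open>spread\<close>, the saturated sets through \<open>B\<close> are contained in at most a
  sixteenth of the cubes through \<open>B\<close>. So some cube contains a copy of \<open>P\<close> without saturated
  subsets, which enlarges \<open>H\<close>.
\<close>
lemma balanced_collection:
  fixes P :: "'a set" and r :: "'a rel" and G :: "nat set" and D K L \<eta> \<tau> :: real
  assumes "finite G" "F \<subseteq> Pow G" "finite P" "2 \<le> card P" "s \<ge> 1" "D \<ge> 1" "K \<ge> 1" "\<eta> \<ge> 0"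
    and L: "\<And>B. B \<in> F \<Longrightarrow> L \<le> real (card {Q \<in> cubes G s m. B \<in> cube Q})" "L \<ge> 0"
    and spread: "\<And>A S B. A \<in> induced_copies P r F \<Longrightarrow> S \<subseteq> A \<Longrightarrow> 2 \<le> card S \<Longrightarrow> B \<in> S \<Longrightarrow>
        real (card {Q \<in> cubes G s m. S \<subseteq> cube Q}) * D ^ (card S - 1) \<le> \<eta> * real (card {Q \<in> cubes G s m. B \<in> cube Q})"
    and \<eta>: "\<eta> * K * 2 ^ card P \<le> 1 / 16"
    and \<tau>: "16 * real (card P) * \<tau> \<le> K * D ^ (card P - 1) * real (card F)"
    and dense: "real (La_star m P r) * real (card (cubes G s m)) < (15/16)\<^sup>2 * real (card F) * L"
  obtains H where "H \<subseteq> induced_copies P r F" "\<tau> \<le> real (card H)"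
    "\<And>S. S \<noteq> {} \<Longrightarrow> card S \<le> card P \<Longrightarrow> real (family_degree H S) \<le> 2 * K * D ^ (card P - card S)"
proof -
  let ?p = "card P" and ?C = "cubes G s m"
  let ?N = "\<lambda>S. real (card {Q \<in> ?C. S \<subseteq> cube Q})" and ?n = "\<lambda>B. real (card {Q \<in> ?C. B \<in> cube Q})"
  define ok where "ok H \<longleftrightarrow> H \<subseteq> induced_copies P r F \<and> (\<forall>S. S \<noteq> {} \<and> card S \<le> ?p \<longrightarrow> real (family_degree H S) \<le> 2 * K * D ^ (?p - card S))" for H
  have fF: "finite F" using assms(1,2) finite_subset by blast
  have "induced_copies P r F \<subseteq> Pow F" using induced_copy_subset by blast
  hence fI: "finite (induced_copies P r F)" using fF finite_subset by blast
  have ok0: "ok {}" using assms(6,7) by (auto simp: ok_def family_degree_def)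
  have bound: "\<forall>H. ok H \<longrightarrow> card H < Suc (card (induced_copies P r F))" 
    unfolding ok_def using card_mono[OF fI] by (simp add: le_imp_less_Suc)
  obtain H where H: "ok H" and max: "\<And>H'. ok H' \<Longrightarrow> card H' \<le> card H"
    using ex_has_greatest_nat[OF ok0 bound] by blast
  have HI: "H \<subseteq> induced_copies P r F" and Hdeg: "\<And>S. S \<noteq> {} \<Longrightarrow> card S \<le> ?p \<Longrightarrow> real (family_degree H S) \<le> 2 * K * D ^ (?p - card S)"
    using H unfolding ok_def by blast+
  have fH: "finite H" using HI fI finite_subset by blast
  have D1: "1 \<le> D ^ i" for i using assms(6) by simp
  have "\<tau> \<le> real (card H)"
  proof (rule ccontr)
    assume "\<not> \<tau> \<le> real (card H)"
    \<comment> \<open>Both thresholds are at most half of the permitted degree, so one more copy does no harm.\<close>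
    define F' where "F' = {B \<in> F. real (family_degree H {B}) < K * D ^ (?p - 1)}"
    define \<S> where "\<S> = {S. S \<subseteq> F' \<and> 2 \<le> card S \<and> (\<exists>A\<in>H. S \<subseteq> A) \<and> D ^ (?p - card S) \<le> real (family_degree H S)}"
    have F'F: "F' \<subseteq> F" by (auto simp: F'_def)
    have fF': "finite F'" using F'F fF finite_subset by blast
    have f\<S>: "finite \<S>" by (rule finite_subset[of _ "Pow F'"]) (auto simp: \<S>_def fF')
    have KD: "0 < K * D ^ (?p - 1)" using assms(7) D1[of "?p - 1"] by (intro mult_pos_pos) linarith+
    have cardF': "15/16 * real (card F) \<le> real (card F')"
    proof -
      have "real (card (F - F')) * (K * D ^ (?p - 1)) \<le> (\<Sum>B\<in>F - F'. real (family_degree H {B}))"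
        by (rule sum_bounded_below) (auto simp: F'_def)
      also have "\<dots> \<le> (\<Sum>B\<in>F. real (family_degree H {B}))"
        using fF by (intro sum_mono2) auto
      also have "\<dots> = real (\<Sum>A\<in>H. card {B \<in> F. {B} \<subseteq> A})"
        unfolding family_degree_def using sum_card_swap[OF fH fF, of "\<lambda>A B. {B} \<subseteq> A"] by simp
      also have "\<dots> \<le> real (\<Sum>A\<in>H. ?p)"
      proof (intro of_nat_mono sum_mono)
        fix A assume "A \<in> H"
        hence A: "A \<in> induced_copies P r F" using HI by blast
        have "finite A" using induced_copy_subset[OF A] fF finite_subset by blast
        hence "card {B \<in> F. {B} \<subseteq> A} \<le> card A" by (intro card_mono) auto
        thus "card {B \<in> F. {B} \<subseteq> A} \<le> ?p" using card_induced_copy[OF A] by simp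
      qed
      also have "\<dots> = real ?p * real (card H)" by simp
      also have "\<dots> \<le> real ?p * \<tau>" using \<open>\<not> \<tau> \<le> real (card H)\<close> by (intro mult_left_mono) auto
      finally have "(K * D ^ (?p - 1)) * (16 * real (card (F - F'))) \<le> (K * D ^ (?p - 1)) * real (card F)"
        using \<tau> by (simp add: algebra_simps)
      hence "16 * real (card (F - F')) \<le> real (card F)" using KD by (simp only: mult_le_cancel_left_pos)
      moreover have "card (F - F') = card F - card F'" using F'F fF' by (simp add: card_Diff_subset)
      moreover have "card F' \<le> card F" using F'F fF by (rule card_mono[rotated])
      ultimately show ?thesis by (simp add: of_nat_diff)
    qed
    have light: "(\<Sum>S | S \<in> \<S> \<and> B \<in> S. ?N S) \<le> 1/16 * ?n B" if B: "B \<in> F'" for B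
    proof -
      let ?T = "{S. S \<in> \<S> \<and> B \<in> S}"
      have fT: "finite ?T" using f\<S> by simp
      have one: "?N S * D ^ (?p - 1) \<le> \<eta> * ?n B * real (family_degree H S)" if ST: "S \<in> ?T" for S
      proof -
        obtain A where A: "A \<in> H" "S \<subseteq> A" and S: "2 \<le> card S" "D ^ (?p - card S) \<le> real (family_degree H S)" "B \<in> S"
          using ST by (auto simp: \<S>_def)
        have AI: "A \<in> induced_copies P r F" using A HI by blast
        have "finite A" using induced_copy_subset[OF AI] fF finite_subset by blast
        hence "card S \<le> ?p" using card_mono[OF _ A(2)] card_induced_copy[OF AI] by simp
        hence e: "?p - 1 = (card S - 1) + (?p - card S)" using S(1) by simp
        have "?N S * D ^ (?p - 1) = (?N S * D ^ (card S - 1)) * D ^ (?p - card S)"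
          unfolding e power_add by simp
        also have "\<dots> \<le> (\<eta> * ?n B) * real (family_degree H S)"
        proof (rule mult_mono)
          show "?N S * D ^ (card S - 1) \<le> \<eta> * ?n B" by (rule spread[OF AI A(2) S(1,3)])
        qed (use S assms(6,8) in auto)
        finally show ?thesis .
      qed
      have "(\<Sum>S\<in>?T. family_degree H S) = (\<Sum>A\<in>H. card {S \<in> ?T. S \<subseteq> A})"
        unfolding family_degree_def by (rule sum_card_swap[OF fT fH])
      also have "\<dots> = (\<Sum>A | A \<in> H \<and> {B} \<subseteq> A. card {S \<in> ?T. S \<subseteq> A})"
        using fH by (intro sum.mono_neutral_right) (auto simp: card_eq_0_iff)
      also have "\<dots> \<le> (\<Sum>A | A \<in> H \<and> {B} \<subseteq> A. 2 ^ ?p)"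
      proof (rule sum_mono)
        fix A assume "A \<in> {A. A \<in> H \<and> {B} \<subseteq> A}"
        hence A: "A \<in> induced_copies P r F" using HI by blast
        have fA: "finite A" using induced_copy_subset[OF A] fF finite_subset by blast
        hence "card {S \<in> ?T. S \<subseteq> A} \<le> card (Pow A)" by (intro card_mono) auto
        thus "card {S \<in> ?T. S \<subseteq> A} \<le> 2 ^ ?p" using card_induced_copy[OF A] fA by (simp add: card_Pow)
      qed
      also have "\<dots> = family_degree H {B} * 2 ^ ?p" by (simp add: family_degree_def)
      finally have "real (\<Sum>S\<in>?T. family_degree H S) \<le> real (family_degree H {B} * 2 ^ ?p)"
        by (rule of_nat_mono)
      also have "\<dots> = real (family_degree H {B}) * 2 ^ ?p" by simp
      also have "\<dots> \<le> (K * D ^ (?p - 1)) * 2 ^ ?p"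
        using B by (intro mult_right_mono) (auto simp: F'_def)
      finally have deg: "(\<Sum>S\<in>?T. real (family_degree H S)) \<le> K * D ^ (?p - 1) * 2 ^ ?p" by simp
      have "(\<Sum>S\<in>?T. ?N S) * D ^ (?p - 1) \<le> (\<Sum>S\<in>?T. \<eta> * ?n B * real (family_degree H S))"
        unfolding sum_distrib_right by (rule sum_mono) (rule one)
      also have "\<dots> = \<eta> * ?n B * (\<Sum>S\<in>?T. real (family_degree H S))" by (simp add: sum_distrib_left)
      also have "\<dots> \<le> \<eta> * ?n B * (K * D ^ (?p - 1) * 2 ^ ?p)"
        using deg assms(8) by (intro mult_left_mono) auto
      also have "\<dots> = (\<eta> * K * 2 ^ ?p) * ?n B * D ^ (?p - 1)" by simp
      also have "\<dots> \<le> 1/16 * ?n B * D ^ (?p - 1)"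
        using \<eta> assms(6) by (intro mult_right_mono) auto
      finally show ?thesis by (rule mult_right_le_imp_le) (use D1[of "?p - 1"] in linarith)
    qed
    have large: "real (La_star m P r) * real (card ?C) < (1 - 1/16) * real (card F') * L"
    proof -
      have "(15/16)\<^sup>2 * real (card F) * L = 15/16 * (15/16 * real (card F)) * L" by (simp add: power2_eq_square)
      also have "\<dots> \<le> 15/16 * real (card F') * L" using cardF' L(2) by (intro mult_right_mono mult_left_mono) auto
      finally show ?thesis using dense by simp
    qed
    obtain Q where Q: "Q \<in> ?C" 
      "real (La_star m P r) + real (card {S \<in> \<S>. S \<subseteq> cube Q}) < real (card (F' \<inter> cube Q))"
    proof (rule exists_dense_cube[of G F' \<S> s m "1/16" L "real (La_star m P r)"])
      show "F' \<subseteq> Pow G" using F'F assms(2) by blast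
      show "\<And>S. S \<in> \<S> \<Longrightarrow> S \<noteq> {} \<and> S \<subseteq> F'" by (auto simp: \<S>_def)
      show "\<And>B. B \<in> F' \<Longrightarrow> L \<le> ?n B" using L F'F by blast
    qed (use assms(1) f\<S> light large in auto)
    have "S \<noteq> {}" if "S \<in> \<S>" for S using that by (auto simp: \<S>_def)
    hence "\<forall>S\<in>\<S>. \<exists>B. B \<in> S" by (simp add: ex_in_conv)
    then obtain g where g: "\<And>S. S \<in> \<S> \<Longrightarrow> g S \<in> S" by metis
    \<comment> \<open>Removing one member of every saturated set in the cube destroys all of them.\<close>
    define F'' where "F'' = F' \<inter> cube Q - g ` {S \<in> \<S>. S \<subseteq> cube Q}"
    have "card (F' \<inter> cube Q) - card (g ` {S \<in> \<S>. S \<subseteq> cube Q}) \<le> card F''"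
      unfolding F''_def using f\<S> by (intro diff_card_le_card_Diff) auto
    moreover have "card (g ` {S \<in> \<S>. S \<subseteq> cube Q}) \<le> card {S \<in> \<S>. S \<subseteq> cube Q}"
      using f\<S> by (intro card_image_le) auto
    ultimately have "La_star m P r < card F''" using Q(2) by linarith
    then obtain f where f: "f ` P \<subseteq> F''" "inj_on f P" "\<forall>x\<in>P. \<forall>y\<in>P. f x \<subset> f y \<longleftrightarrow> (x, y) \<in> r \<and> x \<noteq> y"
      using copy_in_dense_subcube[OF Q(1) assms(5), of F'' P r] by (auto simp: F''_def)
    define A where "A = f ` P"
    have AF': "A \<subseteq> F'" using f(1) by (auto simp: A_def F''_def)
    have AI: "A \<in> induced_copies P r F"
    proof -
      have "induced_embedding P r F f"
        unfolding induced_embedding_def using f(2,3) AF' F'F by (auto simp: A_def)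
      thus ?thesis unfolding induced_copies_def A_def by blast
    qed
    have fA: "finite A" using assms(3) by (simp add: A_def)
    have cA: "card A = ?p" by (rule card_induced_copy[OF AI])
    have free: "S \<notin> \<S>" if "S \<subseteq> A" for S
    proof
      assume S: "S \<in> \<S>"
      have "S \<subseteq> cube Q" using that f(1) by (auto simp: A_def F''_def)
      hence "g S \<notin> F''" using S by (auto simp: F''_def)
      thus False using g[OF S] that f(1) by (auto simp: A_def)
    qed
    \<comment> \<open>A member of \<open>H\<close> has degree \<open>1 = D ^ 0\<close>, hence is saturated itself.\<close>
    have "A \<notin> H"
    proof
      assume "A \<in> H"
      hence "{A' \<in> H. A \<subseteq> A'} \<noteq> {}" by blast
      hence "family_degree H A \<ge> 1" using fH unfolding family_degree_def by (simp add: Suc_le_eq card_gt_0_iff)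
      hence "A \<in> \<S>" using AF' cA assms(4) \<open>A \<in> H\<close> by (auto simp: \<S>_def)
      thus False using free by blast
    qed
    have "ok (insert A H)"
      unfolding ok_def
    proof (intro conjI allI impI)
      show "insert A H \<subseteq> induced_copies P r F" using HI AI by blast
      fix S :: "nat set set" assume S: "S \<noteq> {} \<and> card S \<le> ?p"
      let ?b = "D ^ (?p - card S)"
      have b1: "1 \<le> ?b" by (rule D1)
      hence "1 * ?b \<le> K * ?b" using assms(7) by (intro mult_right_mono) auto
      hence b: "1 \<le> ?b" "?b \<le> K * ?b" using b1 by simp_all
      show "real (family_degree (insert A H) S) \<le> 2 * K * ?b"
      proof (cases "S \<subseteq> A")
        case False
        thus ?thesis using Hdeg S \<open>A \<notin> H\<close> fH by (simp add: family_degree_insert)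
      next
        case True
        hence "finite S" using fA finite_subset by blast
        hence "card S \<ge> 1" using S by (simp add: Suc_le_eq card_gt_0_iff)
        have "real (family_degree H S) \<le> K * ?b"
        proof (cases "card S = 1")
          case True
          then obtain B where "S = {B}" by (auto simp: card_1_singleton_iff)
          thus ?thesis using \<open>S \<subseteq> A\<close> AF' by (auto simp: F'_def)
        next
          case False
          hence "2 \<le> card S" using \<open>card S \<ge> 1\<close> by simp
          hence "\<not> (\<exists>A\<in>H. S \<subseteq> A) \<or> real (family_degree H S) < ?b"
            using free[OF True] True AF' by (auto simp: \<S>_def)
          thus ?thesis
          proof
            assume "\<not> (\<exists>A\<in>H. S \<subseteq> A)"
            hence "{A \<in> H. S \<subseteq> A} = {}" by blast
            thus ?thesis using b unfolding family_degree_def by (simp only: card.empty)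
          qed (use b in linarith)
        qed
        hence "1 + real (family_degree H S) \<le> 2 * (K * ?b)" using b by linarith
        thus ?thesis using True \<open>A \<notin> H\<close> fH by (simp add: family_degree_insert)
      qed
    qed
    hence "card (insert A H) \<le> card H" by (rule max)
    thus False using fH \<open>A \<notin> H\<close> by simp
  qed
  thus ?thesis using that HI Hdeg by blast
qed

section \<open>The parameter of a poset\<close>

lemma finite_mu_ratios: "finite P \<Longrightarrow> finite {real (d_star D r) / (real (card D) - 1) | D. D \<subseteq> P \<and> 2 \<le> card D}"
  by (rule finite_subset[of _ "(\<lambda>D. real (d_star D r) / (real (card D) - 1)) ` Pow P"]) auto

lemma mu_nonneg:
  assumes "finite P" "2 \<le> card P"
  shows "0 \<le> mu P r"
proof -
  let ?R = "{real (d_star D r) / (real (card D) - 1) | D. D \<subseteq> P \<and> 2 \<le> card D}"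
  have "?R \<noteq> {}" using assms(2) by blast
  hence "mu P r \<in> ?R" unfolding mu_def by (rule Min_in[OF finite_mu_ratios[OF assms(1)]])
  thus ?thesis by auto
qed

lemma mu_le_d_star:
  assumes "finite P" "D \<subseteq> P" "2 \<le> card D"
  shows "mu P r * (real (card D) - 1) \<le> real (d_star D r)"
proof -
  have "mu P r \<le> real (d_star D r) / (real (card D) - 1)"
    unfolding mu_def using assms(2,3) by (intro Min_le[OF finite_mu_ratios[OF assms(1)]]) blast
  thus ?thesis using assms(3) by (simp add: le_divide_eq)
qed

section \<open>Frequencies of cubes\<close>

lemma card_packings_blocks_pos:
  assumes "finite G"
  shows "s * m \<le> card G \<Longrightarrow> 0 < card (packings (blocks G s) m)"
proof (induction m)
  case (Suc m)
  have "0 < (card G - s * m) choose s" using Suc.prems by (intro zero_less_binomial) simp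
  thus ?case using Suc by (simp add: card_packings_blocks_Suc[OF assms])
qed simp

text \<open>
  The numerical hypothesis on \<open>s\<close> and \<open>m\<close> says that the relative error \<open>x\<close> in the proportion of uncut
  blocks adds up to at most \<open>1/8\<close> over \<open>m\<close> blocks; it also forces the blocks of a packing to cover at most
  half of the points.
\<close>
lemma pure_blocks_fraction:
  assumes "finite G" "2 \<le> s" "1 \<le> m" "4 * (s * (s - 1)) * m + s * m + s \<le> card G"
    and "G' \<subseteq> G" "card G \<le> card G' + s * m"
  defines "x \<equiv> real (s * (s - 1)) / (2 * (real (card G) - real (s * m) - real s))"
  shows "0 \<le> x" "real m * x \<le> 1/8"
    "2 * (1 - x) / 2 ^ s * real (card G' choose s) \<le> real (card (pure_blocks G' s B))"
    "2 * s \<le> card G'"  "card G \<le> 2 * card G'"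
proof -
  let ?h = "real (card G) - real (s * m) - real s"
  obtain u where s: "s = Suc (Suc u)" using assms(2) by (metis Suc_le_D numeral_2_eq_2 Suc_le_mono)
  have a: "s \<le> 4 * (s * (s - 1))" by (simp add: s)
  have "4 * (s * (s - 1)) * 1 \<le> 4 * (s * (s - 1)) * m" using assms(3) by (rule mult_le_mono2)
  hence nat: "4 * (s * (s - 1)) * m \<ge> s" "4 * (s * (s - 1)) * m > 0" using a assms(2) by linarith+
  have nat2: "4 * (s * (s - 1)) * m \<ge> s * m" using a by (rule mult_le_mono1)
  have h4: "4 * real (s * (s - 1)) * real m \<le> ?h"
  proof -
    have "real (4 * (s * (s - 1)) * m + s * m + s) \<le> real (card G)" using assms(4) by (rule of_nat_mono)
    thus ?thesis by (simp only: of_nat_add of_nat_mult of_nat_numeral)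
  qed
  have h0: "?h > 0"
  proof -
    have "0 < 4 * real (s * (s - 1)) * real m" using nat(2) by simp
    thus ?thesis using h4 by linarith
  qed
  show "0 \<le> x" using h0 by (simp add: x_def)
  have "8 * (real m * y) \<le> 2 * h" if "4 * y * real m \<le> h" for y h :: real
    using that by (simp add: mult_ac)
  from this[OF h4] show "real m * x \<le> 1/8" using h0 by (simp only: x_def times_divide_eq_right pos_divide_le_eq) simp
  show 2: "2 * s \<le> card G'" using nat nat2 assms(4,6) by linarith
  show "card G \<le> 2 * card G'" using nat nat2 assms(4,6) by linarith
  show "2 * (1 - x) / 2 ^ s * real (card G' choose s) \<le> real (card (pure_blocks G' s B))"
    unfolding x_def
  proof (rule pure_blocks_lower)
    show "finite G'" using assms(1,5) finite_subset by blast
    show "?h + real s \<le> real (card G')" using assms(6) by (simp flip: of_nat_mult of_nat_add)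
  qed (use 2 h0 assms(2) in auto)
qed

lemma cubes_through_lower:
  assumes "finite G" "2 \<le> s" "1 \<le> m" "4 * (s * (s - 1)) * m + s * m + s \<le> card G" "B \<subseteq> G"
  shows "7/8 * 2 ^ m / 2 ^ (s * m) * real (card (packings (blocks G s) m)) \<le> real (card {Q \<in> cubes G s m. B \<in> cube Q})"
proof -
  let ?x = "real (s * (s - 1)) / (2 * (real (card G) - real (s * m) - real s))"
  note f = pure_blocks_fraction[OF assms(1-4)]
  have x: "0 \<le> ?x" "real m * ?x \<le> 1/8" using f(1,2)[of G] by auto
  have x1: "?x \<le> 1"
  proof -
    have "1 * ?x \<le> real m * ?x" using x(1) assms(3) by (intro mult_right_mono) auto
    thus ?thesis using x(2) by linarith
  qed
  have "1 + real m * (- ?x) \<le> (1 + (- ?x)) ^ m" using x1 by (intro Bernoulli_inequality) auto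
  hence "7/8 \<le> (1 - ?x) ^ m" using x(2) by simp
  hence "7/8 * (2 ^ m / 2 ^ (s * m)) \<le> (1 - ?x) ^ m * (2 ^ m / 2 ^ (s * m))"
    by (rule mult_right_mono) simp
  also have "\<dots> = (2 * (1 - ?x) / 2 ^ s) ^ m" by (simp only: power_divide power_mult_distrib power_mult) simp
  finally have "7/8 * 2 ^ m / 2 ^ (s * m) * real (card (packings (blocks G s) m)) \<le> (2 * (1 - ?x) / 2 ^ s) ^ m * real (card (packings (blocks G s) m))"
    by (intro mult_right_mono) auto
  also have "\<dots> \<le> real (card (packings (pure_blocks G s B) m))"
    using x1 by (intro pure_packings_lower assms(1) f(3)) auto
  finally show ?thesis by (simp add: card_cubes_through assms)
qed

lemma pure_packings_extend:
  assumes "finite G" "2 \<le> s" "1 \<le> m" "4 * (s * (s - 1)) * m + s * m + s \<le> card G" "j < m"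
  shows "(real (card G) / (4 * real s)) ^ s * real (card (packings (pure_blocks G s B) j)) \<le> real (card (packings (pure_blocks G s B) (Suc j)))"
proof (rule pure_packings_Suc_lower[OF assms(1)])
  fix G' assume G': "G' \<subseteq> G" "card G' = card G - s * j"
  define x where "x = real (s * (s - 1)) / (2 * (real (card G) - real (s * m) - real s))"
  have "s * j \<le> s * m" using assms(5) by simp
  hence "card G \<le> card G' + s * m" using G'(2) by linarith
  note f = pure_blocks_fraction[OF assms(1-4) G'(1) this, folded x_def]
  have x1: "1/2 \<le> 1 - x"
  proof -
    have "1 * x \<le> real m * x" using f(1) assms(3) by (intro mult_right_mono) auto
    thus ?thesis using f(2) by linarith
  qed
  have "real (card G) / (4 * real s) \<le> (1/2) * (real (card G') / real s)"
    using f(5) assms(2) by (simp add: divide_simps)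
  hence "(real (card G) / (4 * real s)) ^ s \<le> ((1/2) * (real (card G') / real s)) ^ s"
    by (intro power_mono) auto
  also have "\<dots> = 1 / 2 ^ s * (real (card G') / real s) ^ s" by (simp add: power_mult_distrib power_divide)
  also have "\<dots> \<le> 2 * (1 - x) / 2 ^ s * real (card G' choose s)"
  proof (rule mult_mono)
    show "1 / 2 ^ s \<le> 2 * (1 - x) / 2 ^ s" using x1 by (intro divide_right_mono) auto
    show "(real (card G') / real s) ^ s \<le> real (card G' choose s)"
      using binomial_ge_n_over_k_pow_k[of s "card G'", where ?'a = real] f(4) by simp
  qed (use x1 in auto)
  also have "\<dots> \<le> real (card (pure_blocks G' s B))" by (rule f(3))
  finally show "(real (card G) / (4 * real s)) ^ s \<le> real (card (pure_blocks G' s B))" .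
qed

text \<open>
  The point of this bound is its shape: it is a \<open>d\<close>-th power, with \<open>d\<close> the number of blocks in
  which the members of \<open>S\<close> differ, and \<open>d\<close> is at least \<open>mu P r\<close> times \<open>|S| - 1\<close>.
\<close>
lemma cubes_containing_upper:
  assumes "finite G" "2 \<le> s" "1 \<le> m" "4 * (s * (s - 1)) * m + s * m + s \<le> card G"
    and "finite P" "A \<in> induced_copies P r (Pow G)" "S \<subseteq> A" "2 \<le> card S" "B \<in> S" 
    and "{Q \<in> cubes G s m. S \<subseteq> cube Q} \<noteq> {}"
  obtains d where "1 \<le> d" "d \<le> m" "mu P r * (real (card S) - 1) \<le> real d"
    "real (card {Q \<in> cubes G s m. S \<subseteq> cube Q}) \<le> 
      (real m * real (d * s) ^ (s - 1) * (4 * real s / real (card G)) ^ s) ^ d * real (card {Q \<in> cubes G s m. B \<in> cube Q})"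
proof -
  obtain f where f: "A = f ` P" "f ` P \<subseteq> Pow G" "inj_on f P" "\<forall>x\<in>P. \<forall>y\<in>P. f x \<subset> f y \<longleftrightarrow> (x, y) \<in> r \<and> x \<noteq> y"
    using assms(6) by (auto simp: induced_copies_def induced_embedding_def)
  define D where "D = {x \<in> P. f x \<in> S}"
  have D: "D \<subseteq> P" "f ` D = S" using assms(7) f(1) by (auto simp: D_def)
  have injD: "inj_on f D" using f(3) D(1) by (rule inj_on_subset)
  have cD: "card D = card S" using card_image[OF injD] D(2) by simp
  have "D \<noteq> {}" using cD assms(8) by auto
  obtain Q where Q: "Q \<in> cubes G s m" "S \<subseteq> cube Q" using assms(10) by blast
  let ?U = "\<Union>S - \<Inter>S"
  obtain d where d: "card ?U = d * s" "d_star D r \<le> d" "d \<le> m"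
  proof (rule d_star_le_blocks[OF assms(1) Q(1) _ \<open>D \<noteq> {}\<close>])
    show "f ` D \<subseteq> cube Q" using D(2) Q(2) by simp
    show "\<forall>x\<in>D. \<forall>y\<in>D. f x \<subset> f y \<longleftrightarrow> (x, y) \<in> r \<and> x \<noteq> y" using f(4) D(1) by blast
  qed (use assms(2) injD D(2) in auto)
  have UG: "?U \<subseteq> G" using assms(7) f(1,2) by blast
  have "?U \<noteq> {}"
  proof
    assume "?U = {}"
    hence "S \<subseteq> {\<Union>S}" by blast
    hence "card S \<le> card {\<Union>S}" by (intro card_mono) auto
    thus False using assms(8) by simp
  qed
  hence "card ?U > 0" using UG assms(1) finite_subset by (auto simp: card_gt_0_iff)
  hence "1 \<le> d" using d(1) by (cases d) auto
  have mu: "mu P r * (real (card S) - 1) \<le> real d"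
    using mu_le_d_star[OF assms(5) D(1), of r] cD assms(8) d(2) by simp
  define q where "q = (real (card G) / (4 * real s)) ^ s"
  have G0: "card G > 0" using assms(2,4) by linarith
  have q0: "q > 0" unfolding q_def using G0 assms(2) by (intro zero_less_power divide_pos_pos) auto
  have B: "B \<subseteq> G" using assms(7,9) f(1,2) by blast
  have "q ^ d * real (card {Q \<in> cubes G s m. S \<subseteq> cube Q}) \<le> q ^ d * real (card (tiling_packings (pure_blocks G s B) m ?U))"
    using card_cubes_containing[OF assms(1,9)] q0 by (intro mult_left_mono) auto
  also have "\<dots> \<le> (real m * real (d * s) ^ (s - 1)) ^ d * real (card (packings (pure_blocks G s B) m))"
  proof (rule tiling_packings_upper[where G = G])
    show "pure_blocks G s B \<subseteq> blocks G s" by (auto simp: pure_blocks_def)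
    show "\<And>j. j < m \<Longrightarrow> q * real (card (packings (pure_blocks G s B) j)) \<le> real (card (packings (pure_blocks G s B) (Suc j)))"
      unfolding q_def by (rule pure_packings_extend[OF assms(1-4)])
  qed (use assms(1,2) UG d(1) q0 in auto)
  finally have "real (card {Q \<in> cubes G s m. S \<subseteq> cube Q}) \<le> (real m * real (d * s) ^ (s - 1)) ^ d / q ^ d * real (card {Q \<in> cubes G s m. B \<in> cube Q})"
    using q0 by (simp add: card_cubes_through[OF assms(1) B] pos_le_divide_eq mult.commute)
  also have "(real m * real (d * s) ^ (s - 1)) ^ d / q ^ d = (real m * real (d * s) ^ (s - 1) * (4 * real s / real (card G)) ^ s) ^ d"
  proof -
    have "4 * real s / real (card G) = 1 / (real (card G) / (4 * real s))" by simp
    hence "(4 * real s / real (card G)) ^ s = 1 / q" unfolding q_def by (simp only: power_divide power_one)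
    thus ?thesis by (simp add: power_divide)
  qed
  finally show ?thesis using that \<open>1 \<le> d\<close> d(3) mu by blast
qed

section \<open>Choice of the parameters\<close>

lemma K_const_eq:
  assumes "finite P" "2 \<le> card P"
  shows "K_const P = 4 * real (card P) * 2 ^ card P"
  using assms(2) by (simp add: K_const_def powr_add powr_realpow)

text \<open>
  For \<open>d = 1\<close> the left side is \<open>c/n\<close>, and increasing \<open>d\<close> costs a geometric factor as long as the base stays
  below \<open>3/4\<close>; the constant \<open>3\<close> bounds \<open>d (3/4)^(d-1)\<close>.
\<close>
lemma linear_power_bound:
  fixes c :: real
  assumes "0 \<le> c" "c * real m / real n \<le> 3/4" "1 \<le> d" "d \<le> m"
  shows "(c * real d / real n) ^ d \<le> 3 * c / real n"
proof -
  obtain e where d: "d = Suc e" using assms(3) by (cases d) auto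
  have b: "real d * (3/4) ^ e \<le> 3"
  proof -
    have "1 + real e * (1/3) \<le> (1 + 1/3) ^ e" by (rule Bernoulli_inequality) simp
    hence "real d * (3/4) ^ e \<le> (3 * (4/3) ^ e) * (3/4) ^ e"
      using d by (intro mult_right_mono) auto
    also have "\<dots> = 3" by (simp flip: power_mult_distrib)
    finally show ?thesis .
  qed
  have "c * real d / real n \<le> c * real m / real n" using assms by (intro divide_right_mono mult_left_mono) auto
  hence "(c * real d / real n) ^ e \<le> (3/4) ^ e" 
    using assms(1,2) by (intro power_mono order_trans[OF _ assms(2)]) auto
  hence "(c * real d / real n) ^ d \<le> (c * real d / real n) * (3/4) ^ e"
    unfolding d power_Suc using assms(1) by (intro mult_left_mono) auto
  also have "\<dots> = (c / real n) * (real d * (3/4) ^ e)" by simp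
  also have "\<dots> \<le> (c / real n) * 3" using assms(1) by (intro mult_left_mono b) auto
  finally show ?thesis by (simp add: mult.commute)
qed

lemma induced_copies_mono:
  assumes "F \<subseteq> F'"
  shows "induced_copies P r F \<subseteq> induced_copies P r F'"
proof
  fix A assume "A \<in> induced_copies P r F"
  then obtain f where f: "A = f ` P" "induced_embedding P r F f" unfolding induced_copies_def by blast
  have "induced_embedding P r F' f"
    using f(2) order_trans[OF _ assms] unfolding induced_embedding_def by simp
  thus "A \<in> induced_copies P r F'" using f(1) unfolding induced_copies_def by blast
qed

text \<open>
  In \<open>small\<close> the number \<open>x\<close> stands for \<open>mu P r * (|S| - 1)\<close>. It is at most \<open>d\<close>, which serves when \<open>k\<close> is
  large, and at most \<open>mu P r * (|P| - 1)\<close>, which serves when \<open>k\<close> is bounded.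
\<close>
lemma supersaturation_from_blocks:
  fixes P :: "'a set" and r :: "'a rel" and C k :: real and n m s t :: nat
  assumes P: "finite P" "2 \<le> card P" and "t > 0"
    and La: "real (La_star m P r) \<le> C * real (m choose (m div 2))"
    and k: "8 \<le> k" "4 * real n \<le> k\<^sup>2 * real m" and m: "1 \<le> m" "m \<le> n"
    and s: "2 \<le> s" "4 * (s * (s - 1)) * m + s * m + s \<le> n"
    and small: "\<And>d x. 1 \<le> d \<Longrightarrow> d \<le> m \<Longrightarrow> x \<le> real d \<Longrightarrow> x \<le> mu P r * (real (card P) - 1) \<Longrightarrow>
        (real m * real (d * s) ^ (s - 1) * (4 * real s / real n) ^ s) ^ d * (k / 8) powr (2 * real t * x) \<le> 1 / (16 * K_const P * 2 ^ card P)"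
    and F: "F \<subseteq> Pow {1..n}" "real (card F) = k * real t * C * real (n choose (n div 2))"
  shows "\<exists>H. H \<subseteq> induced_copies P r F \<and>
    real (card H) \<ge> 1 / (2 * real t) * (k / 8) powr (2 * real t * mu P r * (real (card P) - 1)) * real (card F) \<and>
    (\<forall>S. S \<subseteq> Pow {1..n} \<and> S \<noteq> {} \<longrightarrow> real (family_degree H S) \<le>
       2 * K_const P * (k / 8) powr (2 * real t * mu P r * (real (card P) - real (card S))))"
proof -
  let ?p = "card P" and ?K = "K_const P" and ?G = "{1..n}" and ?C = "cubes {1..n} s m"
  let ?T = "real (card (packings (blocks {1..n} s) m))"
  define D where "D = (k / 8) powr (2 * real t * mu P r)"
  have K: "?K = 4 * real ?p * 2 ^ ?p" by (rule K_const_eq[OF P])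
  have K1: "1 \<le> ?K"
  proof -
    have "1 * 1 \<le> (4 * real ?p) * 2 ^ ?p" using P(2) by (intro mult_mono) auto
    thus ?thesis using K by simp
  qed
  have Dpow: "D ^ j = (k / 8) powr (2 * real t * mu P r * real j)" for j
    unfolding D_def using k(1) by (simp add: powr_power mult_ac)
  have D1: "1 \<le> D" unfolding D_def using k(1) mu_nonneg[OF P, of r] by (intro ge_one_powr_ge_zero) auto
  have deg0: "family_degree {} S = 0" for S by (simp add: family_degree_def)
  show ?thesis
  proof (cases "card F = 0")
    case True
    show ?thesis by (rule exI[of _ "{}"]) (use True K1 in \<open>simp add: deg0\<close>)
  next
    case False
    have nG: "4 * (s * (s - 1)) * m + s * m + s \<le> card ?G" using s(2) by simp
    define L where "L = 7/8 * 2 ^ m / 2 ^ (s * m) * ?T"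
    obtain H where H: "H \<subseteq> induced_copies P r F" "1 / (2 * real t) * D ^ (?p - 1) * real (card F) \<le> real (card H)"
      "\<And>S. S \<noteq> {} \<Longrightarrow> card S \<le> ?p \<Longrightarrow> real (family_degree H S) \<le> 2 * ?K * D ^ (?p - card S)"
    proof (rule balanced_collection[of ?G F P s D ?K "1 / (16 * ?K * 2 ^ ?p)" L m r "1 / (2 * real t) * D ^ (?p - 1) * real (card F)"])
      show "L \<le> real (card {Q \<in> ?C. B \<in> cube Q})" if "B \<in> F" for B
        unfolding L_def using that F(1) by (intro cubes_through_lower s(1) m(1) nG) auto
      show "0 \<le> L" by (simp add: L_def)
      show "real (card {Q \<in> ?C. S \<subseteq> cube Q}) * D ^ (card S - 1) \<le> 1 / (16 * ?K * 2 ^ ?p) * real (card {Q \<in> ?C. B \<in> cube Q})"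
        if A: "A \<in> induced_copies P r F" and S: "S \<subseteq> A" "2 \<le> card S" "B \<in> S" for A S B
      proof (cases "{Q \<in> ?C. S \<subseteq> cube Q} = {}")
        case True
        show ?thesis unfolding True using K1 by simp
      next
        case False
        have A': "A \<in> induced_copies P r (Pow ?G)"
          using A induced_copies_mono[OF F(1)] by (rule subsetD[rotated])
        obtain d where d: "1 \<le> d" "d \<le> m" "mu P r * (real (card S) - 1) \<le> real d"
          "real (card {Q \<in> ?C. S \<subseteq> cube Q}) \<le> 
            (real m * real (d * s) ^ (s - 1) * (4 * real s / real (card ?G)) ^ s) ^ d * real (card {Q \<in> ?C. B \<in> cube Q})"
          by (rule cubes_containing_upper[OF finite_atLeastAtMost s(1) m(1) nG P(1) A' S False])
        have "finite A" by (rule finite_subset[OF order_trans[OF induced_copy_subset[OF A] F(1)]]) simp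
        hence cS: "card S \<le> ?p" using card_mono[OF _ S(1)] card_induced_copy[OF A] by simp
        have "mu P r * (real (card S) - 1) \<le> mu P r * (real ?p - 1)"
          using cS mu_nonneg[OF P, of r] by (intro mult_left_mono) auto
        note sm = small[OF d(1-3) this]
        have e: "D ^ (card S - 1) = (k / 8) powr (2 * real t * (mu P r * (real (card S) - 1)))"
          unfolding Dpow using S(2) by (simp add: of_nat_diff mult.assoc)
        have "real (card {Q \<in> ?C. S \<subseteq> cube Q}) * D ^ (card S - 1) \<le>
          ((real m * real (d * s) ^ (s - 1) * (4 * real s / real n) ^ s) ^ d * real (card {Q \<in> ?C. B \<in> cube Q})) * (k / 8) powr (2 * real t * (mu P r * (real (card S) - 1)))"
          unfolding e using d(4) by (intro mult_right_mono) auto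
        also have "\<dots> = ((real m * real (d * s) ^ (s - 1) * (4 * real s / real n) ^ s) ^ d * (k / 8) powr (2 * real t * (mu P r * (real (card S) - 1)))) * real (card {Q \<in> ?C. B \<in> cube Q})"
          by (simp only: mult_ac)
        also have "\<dots> \<le> 1 / (16 * ?K * 2 ^ ?p) * real (card {Q \<in> ?C. B \<in> cube Q})"
          by (rule mult_right_mono[OF sm]) simp
        finally show ?thesis .
      qed
      show "16 * real ?p * (1 / (2 * real t) * D ^ (?p - 1) * real (card F)) \<le> ?K * D ^ (?p - 1) * real (card F)"
      proof -
        have "16 * real ?p / (2 * real t) \<le> 16 * real ?p / 2"
          using assms(3) by (intro divide_left_mono) auto
        also have "\<dots> \<le> 4 * real ?p * 2 ^ ?p"
        proof -
          have "(2::real) ^ 1 \<le> 2 ^ ?p" using P(2) by (intro power_increasing) auto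
          hence "4 * real ?p * 2 \<le> 4 * real ?p * 2 ^ ?p" by (intro mult_left_mono) auto
          thus ?thesis by simp
        qed
        finally have "16 * real ?p / (2 * real t) * (D ^ (?p - 1) * real (card F)) \<le> ?K * (D ^ (?p - 1) * real (card F))"
          unfolding K using D1 by (intro mult_right_mono) auto
        thus ?thesis by (simp add: mult_ac)
      qed
      show "real (La_star m P r) * real (card ?C) < (15/16)\<^sup>2 * real (card F) * L"
      proof -
        have sm: "s * m \<le> n" using s(2) by linarith
        have T: "?T > 0" using card_packings_blocks_pos[of ?G s m] sm by simp
        have cF: "real (card F) > 0" using False by simp
        have "C > 0"
        proof (rule ccontr)
          assume "\<not> C > 0"
          hence "k * real t * C * real (n choose (n div 2)) \<le> 0"
            using k(1) by (intro mult_nonpos_nonneg mult_nonneg_nonpos) auto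
          thus False using cF F(2) by linarith
        qed
        have n0: "n > 0" using m by linarith
        have "1.4 * (real (La_star m P r) * 2 ^ n) \<le> 1.4 * (C * real (m choose (m div 2)) * 2 ^ n)"
          using La by (intro mult_left_mono mult_right_mono) auto
        also have "\<dots> = C * (1.4 * (real (m choose (m div 2)) * 2 ^ n))" by simp
        also have "\<dots> \<le> C * (k * real (n choose (n div 2)) * 2 ^ m)"
          using middle_binomial_ratio[OF n0 m(2) k(2)] k(1) \<open>C > 0\<close> by (intro mult_left_mono) auto
        also have "\<dots> \<le> real t * (C * (k * real (n choose (n div 2)) * 2 ^ m))"
        proof -
          have "1 * y \<le> real t * y" if "0 \<le> y" for y using that assms(3) by (intro mult_right_mono) auto
          thus ?thesis using k(1) \<open>C > 0\<close> by simp
        qed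
        also have "\<dots> = real (card F) * 2 ^ m" unfolding F(2) by simp
        finally have a: "1.4 * (real (La_star m P r) * 2 ^ n) \<le> real (card F) * 2 ^ m" .
        have fm: "0 < real (card F) * 2 ^ m" using cF by simp
        \<comment> \<open>The losses amount to \<open>(15/16)\<^sup>2 * (7/8) = 0.769...\<close>, and \<open>1.4 * 0.769 > 1\<close>.\<close>
        have "real (La_star m P r) * 2 ^ n < (15/16)\<^sup>2 * (7/8) * (real (card F) * 2 ^ m)"
          using a fm by (simp add: power2_eq_square)
        hence "(real (La_star m P r) * 2 ^ n) * (?T / 2 ^ (s * m)) < ((15/16)\<^sup>2 * (7/8) * (real (card F) * 2 ^ m)) * (?T / 2 ^ (s * m))"
          using T by (intro mult_strict_right_mono) auto
        moreover have "(real (La_star m P r) * 2 ^ n) * (?T / 2 ^ (s * m)) = real (La_star m P r) * real (card ?C)"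
        proof -
          have "(2::real) ^ n = 2 ^ (n - s * m) * 2 ^ (s * m)" using sm by (simp flip: power_add)
          moreover have "real (card ?C) = ?T * 2 ^ (n - s * m)" using card_cubes[of ?G s m] sm by simp
          ultimately show ?thesis by simp
        qed
        moreover have "((15/16)\<^sup>2 * (7/8) * (real (card F) * 2 ^ m)) * (?T / 2 ^ (s * m)) = (15/16)\<^sup>2 * real (card F) * L"
        proof -
          have "(w * v * (f * b)) * (y / z) = w * f * (v * b / z * y)" for w v f b y z :: real by simp
          thus ?thesis unfolding L_def .
        qed
        ultimately show ?thesis by (simp only:)
      qed
    qed (use P s D1 K1 F in auto)
    show ?thesis
    proof (intro exI[of _ H] conjI allI impI)
      show "H \<subseteq> induced_copies P r F" by (rule H(1))
      have "D ^ (?p - 1) = (k / 8) powr (2 * real t * mu P r * (real ?p - 1))"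
        unfolding Dpow using P(2) by (simp add: of_nat_diff)
      thus "real (card H) \<ge> 1 / (2 * real t) * (k / 8) powr (2 * real t * mu P r * (real ?p - 1)) * real (card F)"
        using H(2) by simp
      fix S :: "nat set set" assume "S \<subseteq> Pow {1..n} \<and> S \<noteq> {}"
      hence S: "S \<noteq> {}" by blast
      show "real (family_degree H S) \<le> 2 * ?K * (k / 8) powr (2 * real t * mu P r * (real ?p - real (card S)))"
      proof (cases "card S \<le> ?p")
        case True
        have "D ^ (?p - card S) = (k / 8) powr (2 * real t * mu P r * (real ?p - real (card S)))"
          unfolding Dpow using True by (simp add: of_nat_diff)
        thus ?thesis using H(3)[OF S True] by simp
      next
        case False
        have "\<not> S \<subseteq> A" if "A \<in> H" for A
        proof
          assume "S \<subseteq> A"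
          have A: "A \<in> induced_copies P r F" using that H(1) by blast
          have "finite A" by (rule finite_subset[OF order_trans[OF induced_copy_subset[OF A] F(1)]]) simp
          hence "card S \<le> card A" using \<open>S \<subseteq> A\<close> by (intro card_mono) auto
          thus False using False card_induced_copy[OF A] by simp
        qed
        hence "{A \<in> H. S \<subseteq> A} = {}" by blast
        thus ?thesis using K1 unfolding family_degree_def by (simp only: card.empty) simp
      qed
    qed
  qed
qed

theorem theorem3p1:
  fixes P :: "'a set" and r :: "'a rel" and C :: real and n0 t :: nat
  assumes "finite P" and "partial_order_on P r" and "card P \<ge> 2"
    and "n0 > 0"
    and "\<forall>n\<ge>n0. real (La_star n P r) \<le> C * real (n choose (n div 2))"
    and "t > 0"
  shows "\<exists>n1::nat. \<forall>n\<ge>n1. \<forall>k::real. 8 \<le> k \<and> k \<le> sqrt (4 * real n / real n0) \<longrightarrow>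
    (\<forall>F. F \<subseteq> Pow {1..n} \<and>
         real (card F) = k * real t * C * real (n choose (n div 2)) \<longrightarrow>
      (\<exists>H. H \<subseteq> induced_copies P r F \<and>
         real (card H) \<ge>
           1 / (2 * real t) * (k / 8) powr (2 * real t * mu P r * (real (card P) - 1)) * real (card F) \<and>
         (\<forall>S. S \<subseteq> Pow {1..n} \<and> S \<noteq> {} \<longrightarrow>
           real (family_degree H S) \<le>
             2 * K_const P *
               (k / 8) powr (2 * real t * mu P r * (real (card P) - real (card S))))))"
proof -
  let ?\<mu> = "mu P r"
  define \<eta> where "\<eta> = 1 / (16 * K_const P * 2 ^ card P)"
  have \<eta>0: "\<eta> > 0" using assms(3) by (simp add: \<eta>_def K_const_eq[OF assms(1,3)])
  \<comment> \<open>The next four constants belong to the case of large \<open>k\<close>, that is, \<open>k > R\<close>. The value of \<open>c\<close> makes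
    \<open>c * d / n\<close> the bound for the base of the power in question; the summand \<open>11 * c\<close> of \<open>R\<close> keeps it
    below \<open>3/4\<close>, and the summand \<open>32 * (s * s)\<close> keeps the blocks small compared to \<open>n\<close>.\<close>
  define s where "s = t + 1"
  define a where "a = real s ^ t * (4 * real s) ^ s"
  define c where "c = a / 8 ^ t"
  have a0: "a \<ge> 0" by (simp add: a_def)
  have c0: "c \<ge> 0" using a0 by (simp add: c_def)
  define R where "R = 11 * c + 32 * real (s * s) + 8"
  have R8: "R \<ge> 8" using c0 by (simp add: R_def)
  \<comment> \<open>For \<open>k \<le> R\<close> the factor \<open>D ^ (|S| - 1)\<close> is at most \<open>l\<close>.\<close>
  define l where "l = (R / 8) powr (2 * real t * (?\<mu> * (real (card P) - 1)))"
  define n1 where "n1 = max 112 (max (nat \<lceil>30 * l / \<eta>\<rceil>) (nat \<lceil>3 * c / \<eta>\<rceil>))"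
  show ?thesis
  proof (intro exI[of _ n1] allI impI, elim conjE)
    fix n :: nat and k :: real and F
    assume n: "n1 \<le> n" and k: "8 \<le> k" "k \<le> sqrt (4 * real n / real n0)"
      and F: "F \<subseteq> Pow {1..n}" "real (card F) = k * real t * C * real (n choose (n div 2))"
    have n112: "112 \<le> n" using n by (simp add: n1_def)
    have nl: "30 * l / \<eta> \<le> real n" and nc: "3 * c / \<eta> \<le> real n" using n by (simp_all add: n1_def)
    define m where "m = nat \<lceil>4 * real n / k\<^sup>2\<rceil>"
    have k0: "k\<^sup>2 > 0" using k(1) by simp
    have k64: "64 \<le> k\<^sup>2" using power_mono[OF k(1), of 2] by simp
    have "k\<^sup>2 \<le> (sqrt (4 * real n / real n0))\<^sup>2" using k by (intro power_mono) auto
    hence "k\<^sup>2 \<le> 4 * real n / real n0" by simp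
    hence "k\<^sup>2 * real n0 \<le> 4 * real n" using assms(4) by (simp add: le_divide_eq)
    hence n0: "real n0 \<le> 4 * real n / k\<^sup>2" using k0 by (simp add: le_divide_eq mult.commute)
    have m_lower: "4 * real n / k\<^sup>2 \<le> real m" by (simp add: m_def)
    have m_upper: "real m \<le> 4 * real n / k\<^sup>2 + 1"
      using k0 by (simp add: m_def)
    have "n0 \<le> m" using n0 m_lower by linarith
    hence m1: "1 \<le> m" using assms(4) by linarith
    have m8: "real m \<le> 8 * real n / k\<^sup>2"
    proof -
      have "1 \<le> real n0" using assms(4) by simp
      thus ?thesis using n0 m_upper by simp
    qed
    have m16: "real m \<le> real n / 16 + 1"
    proof -
      have "4 * real n / k\<^sup>2 \<le> 4 * real n / 64" using k64 by (intro divide_left_mono) auto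
      thus ?thesis using m_upper by linarith
    qed
    have m14: "14 * real m \<le> real n" using m16 n112 by linarith
    have mn: "m \<le> n" using m14 by linarith
    have kk: "4 * real n \<le> k\<^sup>2 * real m" using m_lower k0 by (simp add: divide_le_eq mult.commute)
    have La: "real (La_star m P r) \<le> C * real (m choose (m div 2))" using assms(5) \<open>n0 \<le> m\<close> by blast
    have k1: "1 \<le> k / 8" using k(1) by simp
    note main = supersaturation_from_blocks[OF assms(1,3,6) La k(1) kk m1 mn _ _ _ F, folded \<eta>_def]
    show "\<exists>H. H \<subseteq> induced_copies P r F \<and>
         real (card H) \<ge> 1 / (2 * real t) * (k / 8) powr (2 * real t * ?\<mu> * (real (card P) - 1)) * real (card F) \<and>
         (\<forall>S. S \<subseteq> Pow {1..n} \<and> S \<noteq> {} \<longrightarrow> real (family_degree H S) \<le>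
             2 * K_const P * (k / 8) powr (2 * real t * ?\<mu> * (real (card P) - real (card S))))"
    proof (cases "k \<le> R")
      case True
      show ?thesis
      proof (rule main[of 2])
        show "4 * (2 * (2 - 1)) * m + 2 * m + 2 \<le> n"
        proof -
          have "14 * m \<le> n" using m14 by linarith
          thus ?thesis using n112 by simp
        qed
        show "(real m * real (d * 2) ^ (2 - 1) * (4 * real 2 / real n) ^ 2) ^ d * (k / 8) powr (2 * real t * x) \<le> \<eta>"
          if d: "1 \<le> d" "d \<le> m" "x \<le> real d" "x \<le> ?\<mu> * (real (card P) - 1)" for d x
        proof -
          let ?c = "128 * real m / real n"
          have c10: "?c \<le> 10" using m14 n112 by (simp add: divide_le_eq)
          have "?c * real m / real n = 128 * (real m / real n)\<^sup>2" by (simp add: power2_eq_square)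
          also have "\<dots> \<le> 128 * (1/14)\<^sup>2"
            using m14 n112 by (intro mult_left_mono power_mono) (auto simp: divide_le_eq)
          also have "\<dots> \<le> 3/4" by (simp add: power2_eq_square)
          finally have "(?c * real d / real n) ^ d \<le> 3 * ?c / real n"
            using d by (intro linear_power_bound) auto
          also have "\<dots> \<le> 30 / real n" using c10 by (intro divide_right_mono) auto
          finally have 1: "(real m * real (d * 2) ^ (2 - 1) * (4 * real 2 / real n) ^ 2) ^ d \<le> 30 / real n"
            by (simp add: power2_eq_square mult_ac)
          have "(k / 8) powr (2 * real t * x) \<le> (k / 8) powr (2 * real t * (?\<mu> * (real (card P) - 1)))"
            using k1 d(4) by (intro powr_mono mult_left_mono) auto
          also have "\<dots> \<le> l" unfolding l_def
            using True k1 mu_nonneg[OF assms(1,3), of r] assms(3) by (intro powr_mono2 mult_nonneg_nonneg) auto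
          finally have "(real m * real (d * 2) ^ (2 - 1) * (4 * real 2 / real n) ^ 2) ^ d * (k / 8) powr (2 * real t * x) \<le> 30 / real n * l"
            by (intro mult_mono 1) auto
          also have "\<dots> \<le> \<eta>" using nl \<eta>0 n112 by (simp add: divide_le_eq mult.commute)
          finally show ?thesis .
        qed
      qed simp
    next
      case False
      have "R * 1 \<le> k * k" using False k(1) R8 by (intro mult_mono) auto
      hence kR: "R \<le> k\<^sup>2" by (simp add: power2_eq_square)
      have mk: "real m * k\<^sup>2 \<le> 8 * real n" using m8 k0 by (simp add: le_divide_eq)
      have mR: "real m * R \<le> 8 * real n"
        using mult_left_mono[OF kR, of "real m"] mk by linarith
      show ?thesis
      proof (rule main[of s])
        show "2 \<le> s" using assms(6) by (simp add: s_def)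
        show "4 * (s * (s - 1)) * m + s * m + s \<le> n"
        proof -
          have "real m * (32 * real (s * s)) \<le> real m * R" using c0 by (intro mult_left_mono) (auto simp: R_def)
          hence "real m * (32 * real (s * s)) \<le> 8 * real n" using mR by linarith
          hence "real (4 * (s * s) * m) \<le> real n" by (simp add: mult_ac)
          hence "4 * (s * s) * m \<le> n" by (simp only: of_nat_le_iff)
          moreover have "4 * (s * (s - 1)) * m + 4 * (s * m) = 4 * (s * s) * m"
            by (simp add: s_def algebra_simps)
          moreover have "s * 1 \<le> s * m" using m1 by (rule mult_le_mono2)
          ultimately show ?thesis by linarith
        qed
        show "(real m * real (d * s) ^ (s - 1) * (4 * real s / real n) ^ s) ^ d * (k / 8) powr (2 * real t * x) \<le> \<eta>"
          if d: "1 \<le> d" "d \<le> m" "x \<le> real d" "x \<le> ?\<mu> * (real (card P) - 1)" for d x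
        proof -
          let ?y = "real m * real (d * s) ^ (s - 1) * (4 * real s / real n) ^ s"
          obtain u where t: "t = Suc u" using assms(6) by (cases t) auto
          have st: "s - 1 = t" "s = Suc t" by (simp_all add: s_def)
          have dk: "real d * k\<^sup>2 \<le> 8 * real n"
            using mult_right_mono[of "real d" "real m" "k\<^sup>2"] d(2) mk by simp
          have "(real m * k\<^sup>2) * (real d * k\<^sup>2) ^ u \<le> (8 * real n) * (8 * real n) ^ u"
            by (rule mult_mono[OF mk power_mono[OF dk]]) auto
          hence "(real m * k\<^sup>2) * (real d * k\<^sup>2) ^ u * real d \<le> (8 * real n) ^ t * real d"
            unfolding t by (intro mult_right_mono) auto
          \<comment> \<open>One factor \<open>k\<^sup>2\<close> is absorbed by \<open>m\<close> and the others by \<open>d \<le> m\<close>; the remaining \<open>d\<close> stays.\<close>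
          hence b: "real m * real d ^ t * (k\<^sup>2) ^ t \<le> (8 * real n) ^ t * real d"
            by (simp add: t power_mult_distrib mult_ac)
          have "(k / 8) ^ (2 * t) = (k\<^sup>2) ^ t / 64 ^ t"
            by (simp add: power_mult power_divide)
          hence "?y * (k / 8) ^ (2 * t) = (real m * real d ^ t * (k\<^sup>2) ^ t) * (a / (64 ^ t * real n ^ s))"
            unfolding st(1) a_def by (simp add: power_mult_distrib power_divide mult_ac)
          also have "\<dots> \<le> ((8 * real n) ^ t * real d) * (a / (64 ^ t * real n ^ s))"
            using a0 by (intro mult_right_mono b) auto
          also have "\<dots> = c * real d / real n"
          proof -
            have "(64::real) ^ t = 8 ^ t * 8 ^ t" by (simp flip: power_mult_distrib)
            thus ?thesis using n112 by (simp add: c_def st(2) power_mult_distrib divide_simps)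
          qed
          finally have y: "?y * (k / 8) ^ (2 * t) \<le> c * real d / real n" .
          have "(k / 8) powr (2 * real t * x) \<le> (k / 8) powr (real (2 * t * d))"
            using k1 d(3) by (intro powr_mono) (auto simp: mult_left_mono)
          also have "\<dots> = ((k / 8) ^ (2 * t)) ^ d"
            using k1 by (subst powr_realpow) (auto simp: power_mult)
          finally have "?y ^ d * (k / 8) powr (2 * real t * x) \<le> ?y ^ d * ((k / 8) ^ (2 * t)) ^ d"
            by (intro mult_left_mono) auto
          also have "\<dots> = (?y * (k / 8) ^ (2 * t)) ^ d" by (simp only: power_mult_distrib)
          also have "\<dots> \<le> (c * real d / real n) ^ d" using k1 by (intro power_mono y) auto
          also have "\<dots> \<le> 3 * c / real n"
          proof (rule linear_power_bound[OF c0 _ d(1,2)])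
            have "real m * (11 * c) \<le> real m * R" by (intro mult_left_mono) (auto simp: R_def)
            hence "c * real m \<le> 3/4 * real n" using mR by (simp add: mult_ac)
            thus "c * real m / real n \<le> 3/4" using n112 by (simp add: divide_le_eq)
          qed
          also have "\<dots> \<le> \<eta>" using nc \<eta>0 n112 by (simp add: divide_le_eq mult.commute)
          finally show ?thesis .
        qed
      qed
    qed
  qed
qed

end
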